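(* Consider the causal adversarial multi-path network model with passive feedback described in the context, with $C$ unit-capacity links and additive jamming, where both reliability and perfect secrecy are required. For any $\vec z=(z_{rw},z_{ro},z_{wo})$ with $z_{rw}+z_{ro}+z_{wo}\le C$, writing $z_r=z_{rw}+z_{ro}$ and $z_w=z_{rw}+z_{wo}$, the capacity for simultaneous reliability and secrecy is $$R=\begin{cases} \max\{0,\,C-z_r\} & \text{if } z_r\ge z_w,\\ \max\{0,\,C-z_w\} & \text{if } z_w>z_r.\end{cases}$$
   Context: Model. A sender (Alice) communicates with a receiver (Bob) over $C$ parallel directed noiseless links $L_1,\dots,L_C$, each of unit capacity (large-alphabet regime). A code of block length $n$ and rate $R$ has message $M$ uniform on $\{0,1\}^{nR}$ and uses private randomness of Alice unknown to the adversary. Passive feedback: the code may operate in $r\ge1$ rounds of lengths summing to $n$; in round $k$ Alice's codewords $\vec X^{(k)}_1,\dots,\vec X^{(k)}_C$ are functions of the message, her randomness, and all words received by Bob in earlier rounds (Alice observes everything Bob receives, causally). Bob decodes $\hat M$ from all received words. Adversary. Calvin, who knows the coding scheme, selects pairwise disjoint link sets $Z_{rw},Z_{ro},Z_{wo}$ (unknown to Alice and Bob) with $|Z_{rw}|\le z_{rw}$, $|Z_{ro}|\le z_{ro}$, $|Z_{wo}|\le z_{wo}$; he reads the links in $Z_r=Z_{rw}\cup Z_{ro}$ and jams the links in $Z_w=Z_{rw}\cup Z_{wo}$. He is causal: his jamming at time $t$ may depend only on symbols observed on $Z_r$ up to time $t$. Under additive jamming $\vec Y_i=\vec X_i+\vec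 E_i$ with $\vec E_i$ chosen by Calvin and $\vec E_i=0$ for $i\notin Z_w$ (so Calvin does not learn Bob's received symbols on links of $Z_{wo}$). Reliability and secrecy. Rate $R$ is achievable if for every $\varepsilon>0$ and all sufficiently large $n$ there is such a code with $\Pr[\hat M\ne M]<\varepsilon$ against every admissible causal adversary and such that the message is perfectly secret from Calvin, i.e. the mutual information between $M$ and everything Calvin observes on the links of $Z_r$ (over all rounds) is zero. The capacity is the supremum of achievable rates. *)

theory Defs
  imports "HOL-Probability.Probability_Mass_Function"
begin

text \<open>
  Conventions.  Links are indexed by 0..C-1, time instants by 0..n-1.
  The link alphabet is Z_q = {0..<q} with addition modulo q (additive jamming);
  the code may choose q (large-alphabet regime), and rates are measured in units
  of log q (each link has unit capacity = one q-ary symbol per time instant).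
  A received/transmitted word family is a function  link => time => symbol.
\<close>

definition round_start :: "nat list \<Rightarrow> nat \<Rightarrow> nat" where
  "round_start ls t =
     Max {sum_list (take k ls) | k. k < length ls \<and> sum_list (take k ls) \<le> t}"

text \<open>Passive feedback with rounds: the symbol Alice sends on link i at time t
  depends (besides message and randomness, fixed here) only on what Bob received
  on the C links during earlier rounds, i.e. before round_start ls t.\<close>
definition feedback_causal ::
  "nat \<Rightarrow> nat list \<Rightarrow> ((nat \<Rightarrow> nat \<Rightarrow> nat) \<Rightarrow> nat \<Rightarrow> nat \<Rightarrow> nat) \<Rightarrow> bool" where
  "feedback_causal C ls A \<longleftrightarrow>
     (\<forall>y y' i t. (\<forall>j<C. \<forall>t'<round_start ls t. y j t' = y' j t') \<longrightarrow> A y i t = A y' i t)"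

definition causal_jammer ::
  "nat set \<Rightarrow> nat set \<Rightarrow> ((nat \<Rightarrow> nat \<Rightarrow> nat) \<Rightarrow> nat \<Rightarrow> nat \<Rightarrow> nat) \<Rightarrow> bool" where
  "causal_jammer Zr Zw E \<longleftrightarrow>
     (\<forall>obs i t. i \<notin> Zw \<longrightarrow> E obs i t = 0) \<and>
     (\<forall>obs obs' i t. (\<forall>j\<in>Zr. \<forall>t'\<le>t. obs j t' = obs' j t') \<longrightarrow> E obs i t = E obs' i t)"

definition admissible_sets ::
  "nat \<Rightarrow> nat \<Rightarrow> nat \<Rightarrow> nat \<Rightarrow> nat set \<Rightarrow> nat set \<Rightarrow> nat set \<Rightarrow> bool" where
  "admissible_sets C zrw zro zwo Zrw Zro Zwo \<longleftrightarrow>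
     Zrw \<subseteq> {..<C} \<and> Zro \<subseteq> {..<C} \<and> Zwo \<subseteq> {..<C} \<and>
     Zrw \<inter> Zro = {} \<and> Zrw \<inter> Zwo = {} \<and> Zro \<inter> Zwo = {} \<and>
     card Zrw \<le> zrw \<and> card Zro \<le> zro \<and> card Zwo \<le> zwo"

text \<open>Closed-loop evolution.  recv q C A E Zr t = what Bob has received at
  times < t on links < C (0 elsewhere).  At time t Alice sends (A h i t mod q),
  where h is Bob's history; Calvin sees the transmitted symbols on Zr at times
  \<le> t (for a feedback-causal A these are A h j t' mod q) and adds E obs i t.\<close>
fun recv ::
  "nat \<Rightarrow> nat \<Rightarrow> ((nat \<Rightarrow> nat \<Rightarrow> nat) \<Rightarrow> nat \<Rightarrow> nat \<Rightarrow> nat) \<Rightarrow>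
   ((nat \<Rightarrow> nat \<Rightarrow> nat) \<Rightarrow> nat \<Rightarrow> nat \<Rightarrow> nat) \<Rightarrow> nat set \<Rightarrow> nat \<Rightarrow> (nat \<Rightarrow> nat \<Rightarrow> nat)" where
  "recv q C A E Zr 0 = (\<lambda>i t'. 0)"
| "recv q C A E Zr (Suc t) =
     (let h = recv q C A E Zr t;
          obs = (\<lambda>j t'. if j \<in> Zr \<and> t' \<le> t then A h j t' mod q else 0)
      in (\<lambda>i t'. if t' = t \<and> i < C then (A h i t + E obs i t) mod q else h i t'))"

definition calvin_view ::
  "nat \<Rightarrow> nat \<Rightarrow> nat \<Rightarrow> ((nat \<Rightarrow> nat \<Rightarrow> nat) \<Rightarrow> nat \<Rightarrow> nat \<Rightarrow> nat) \<Rightarrow>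
   ((nat \<Rightarrow> nat \<Rightarrow> nat) \<Rightarrow> nat \<Rightarrow> nat \<Rightarrow> nat) \<Rightarrow> nat set \<Rightarrow> (nat \<Rightarrow> nat \<Rightarrow> nat)" where
  "calvin_view q C n A E Zr =
     (\<lambda>j t'. if j \<in> Zr \<and> t' < n then A (recv q C A E Zr t') j t' mod q else 0)"

text \<open>A code: alphabet size q, K messages (M uniform on {..<K}), round lengths ls,
  Alice's private randomness U ~ P, encoder enc m u, decoder dec.\<close>
definition error_prob ::
  "nat \<Rightarrow> nat \<Rightarrow> nat \<Rightarrow> nat \<Rightarrow> nat pmf \<Rightarrow>
   (nat \<Rightarrow> nat \<Rightarrow> (nat \<Rightarrow> nat \<Rightarrow> nat) \<Rightarrow> nat \<Rightarrow> nat \<Rightarrow> nat) \<Rightarrow>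
   ((nat \<Rightarrow> nat \<Rightarrow> nat) \<Rightarrow> nat) \<Rightarrow>
   ((nat \<Rightarrow> nat \<Rightarrow> nat) \<Rightarrow> nat \<Rightarrow> nat \<Rightarrow> nat) \<Rightarrow> nat set \<Rightarrow> real" where
  "error_prob q C n K P enc dec E Zr =
     (\<Sum>m<K. measure_pmf.prob P {u. dec (recv q C (enc m u) E Zr n) \<noteq> m}) / real K"

text \<open>Perfect secrecy: M is independent of Calvin's view (equivalently, their
  mutual information is zero): the joint law equals the product of marginals.\<close>
definition perfectly_secret ::
  "nat \<Rightarrow> nat \<Rightarrow> nat \<Rightarrow> nat \<Rightarrow> nat pmf \<Rightarrow>
   (nat \<Rightarrow> nat \<Rightarrow> (nat \<Rightarrow> nat \<Rightarrow> nat) \<Rightarrow> nat \<Rightarrow> nat \<Rightarrow> nat) \<Rightarrow>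
   ((nat \<Rightarrow> nat \<Rightarrow> nat) \<Rightarrow> nat \<Rightarrow> nat \<Rightarrow> nat) \<Rightarrow> nat set \<Rightarrow> bool" where
  "perfectly_secret q C n K P enc E Zr \<longleftrightarrow>
     (let D = bind_pmf (pmf_of_set {..<K})
                (\<lambda>m. map_pmf (\<lambda>u. (m, calvin_view q C n (enc m u) E Zr)) P)
      in D = pair_pmf (map_pmf fst D) (map_pmf snd D))"

definition achievable :: "nat \<Rightarrow> nat \<Rightarrow> nat \<Rightarrow> nat \<Rightarrow> real \<Rightarrow> bool" where
  "achievable C zrw zro zwo R \<longleftrightarrow>
     (\<forall>\<epsilon>>0. \<exists>N. \<forall>n\<ge>N. \<exists>q K ls P enc dec.
        q \<ge> 2 \<and> K \<ge> 1 \<and> real K \<ge> real q powr (real n * R) \<and>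
        ls \<noteq> [] \<and> sum_list ls = n \<and>
        (\<forall>m u. feedback_causal C ls (enc m u)) \<and>
        (\<forall>Zrw Zro Zwo E. admissible_sets C zrw zro zwo Zrw Zro Zwo \<longrightarrow>
            causal_jammer (Zrw \<union> Zro) (Zrw \<union> Zwo) E \<longrightarrow>
            error_prob q C n K P enc dec E (Zrw \<union> Zro) < \<epsilon> \<and>
            perfectly_secret q C n K P enc E (Zrw \<union> Zro)))"

definition capacity :: "nat \<Rightarrow> nat \<Rightarrow> nat \<Rightarrow> nat \<Rightarrow> real" where
  "capacity C zrw zro zwo = Sup {R. achievable C zrw zro zwo R}"

end

(*
  Let z be the larger of the numbers of read and of jammed links.

  Converse. Uniformly random jamming of z_w links makes them useless, and perfect secrecy makes the
  z_r read links useless; a counting argument bounds the number of messages by 2 q^((C - z) n).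

  Achievability. Alice uses one slot per round and a huge prime q. Feedback shows her which links
  have been jammed. A link once seen jammed carries only fresh noise; what Bob receives on it is known
  to Alice through feedback but, the jamming being additive, unknown to Calvin if he does not read the
  link, so it is a shared secret. In a data slot the good links, together with the secrets from the
  bad links in the previous slot, form a word of length C whose C - z power sums are the next message
  symbols (an MDS syndrome): Calvin sees at most z coordinates of it, and Alice can realise any
  message since at most z links are bad. A slot in which a new link gets jammed is repeated, which
  happens at most C times. The log of the jamming is a function of Calvin's view; it is sent to Bob in
  the last slot on all links as a * log + b, where a and b are sums over all links of what Bob
  received in the first two slots. Forging it succeeds with probability O(1/q).

  Secrecy and the forging bound both follow from one coupling: a translation of Alice's noise by an
  amount that depends only on Calvin's view preserves that view while changing the message
  arbitrarily and rotating the key a.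
*)
theory Submission
  imports Defs "HOL-Number_Theory.Cong" "HOL-Computational_Algebra.Polynomial"
begin

section \<open>Closed loop and secrecy\<close>

text \<open>The requirements on a single code for fixed \<open>\<epsilon>\<close> and
  \<open>n\<close>: the converse takes such a code apart, the construction builds one.\<close>

definition reliable_secret_code ::
  "nat \<Rightarrow> nat \<Rightarrow> nat \<Rightarrow> nat \<Rightarrow> real \<Rightarrow> real \<Rightarrow> nat \<Rightarrow> nat \<Rightarrow> nat \<Rightarrow> nat list \<Rightarrow> nat pmf \<Rightarrow>
   (nat \<Rightarrow> nat \<Rightarrow> (nat \<Rightarrow> nat \<Rightarrow> nat) \<Rightarrow> nat \<Rightarrow> nat \<Rightarrow> nat) \<Rightarrow>
   ((nat \<Rightarrow> nat \<Rightarrow> nat) \<Rightarrow> nat) \<Rightarrow> bool" where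
  "reliable_secret_code C zrw zro zwo R \<epsilon> n q K ls P enc dec \<longleftrightarrow>
     q \<ge> 2 \<and> K \<ge> 1 \<and> real K \<ge> real q powr (real n * R) \<and>
     ls \<noteq> [] \<and> sum_list ls = n \<and>
     (\<forall>m u. feedback_causal C ls (enc m u)) \<and>
     (\<forall>Zrw Zro Zwo E. admissible_sets C zrw zro zwo Zrw Zro Zwo \<longrightarrow>
         causal_jammer (Zrw \<union> Zro) (Zrw \<union> Zwo) E \<longrightarrow>
         error_prob q C n K P enc dec E (Zrw \<union> Zro) < \<epsilon> \<and>
         perfectly_secret q C n K P enc E (Zrw \<union> Zro))"

lemma achievable_iff:
  "achievable C zrw zro zwo R \<longleftrightarrow>
     (\<forall>\<epsilon>>0. \<exists>N. \<forall>n\<ge>N. \<exists>q K ls P enc dec.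
        reliable_secret_code C zrw zro zwo R \<epsilon> n q K ls P enc dec)"
  unfolding achievable_def reliable_secret_code_def by (rule refl)

section \<open>Causality and rounds\<close>

lemma round_start_le:
  assumes "ls \<noteq> []"
  shows "round_start ls t \<le> t"
proof -
  let ?A = "{sum_list (take k ls) | k. k < length ls \<and> sum_list (take k ls) \<le> t}"
  have "finite ?A"
    by (rule finite_subset[of _ "{..t}"]) auto
  moreover have "sum_list (take 0 ls) \<in> ?A"
    using assms by (intro CollectI exI[of _ 0]) auto
  ultimately have "Max ?A \<in> ?A"
    by (intro Max_in) auto
  then show ?thesis
    unfolding round_start_def by auto
qed

text \<open>The current round starts no later than \<open>t\<close>, so feedback delayed by rounds
  is in particular strictly causal. The converse sees the rounds only in this form.\<close>

lemma feedback_causalD: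
  assumes "feedback_causal C ls A" "ls \<noteq> []"
    and "\<And>j t'. j < C \<Longrightarrow> t' < t \<Longrightarrow> y j t' = y' j t'"
  shows "A y i t = A y' i t"
  using assms round_start_le[of ls t] unfolding feedback_causal_def
  by (meson less_le_trans)

lemma causal_jammerD:
  assumes "causal_jammer Zr Zw E"
    and "\<And>j t'. j \<in> Zr \<Longrightarrow> t' \<le> t \<Longrightarrow> obs j t' = obs' j t'"
  shows "E obs i t = E obs' i t"
  using assms unfolding causal_jammer_def by blast

text \<open>A run as a solution of equations for the complete word \<open>y\<close> and view
  \<open>V\<close>, without recursion over time. A coupling then only has to exhibit another
  solution. The zeros outside the range make solutions unique.\<close>

definition closed_loop ::
  "nat \<Rightarrow> nat \<Rightarrow> nat \<Rightarrow> ((nat \<Rightarrow> nat \<Rightarrow> nat) \<Rightarrow> nat \<Rightarrow> nat \<Rightarrow> nat) \<Rightarrow>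
   ((nat \<Rightarrow> nat \<Rightarrow> nat) \<Rightarrow> nat \<Rightarrow> nat \<Rightarrow> nat) \<Rightarrow> nat set \<Rightarrow>
   (nat \<Rightarrow> nat \<Rightarrow> nat) \<Rightarrow> (nat \<Rightarrow> nat \<Rightarrow> nat) \<Rightarrow> bool" where
  "closed_loop q C n A E Zr y V \<longleftrightarrow>
     (\<forall>i t. y i t = (if i < C \<and> t < n then (A y i t + E V i t) mod q else 0)) \<and>
     V = (\<lambda>j t. if j \<in> Zr \<and> t < n then A y j t mod q else 0)"

lemma closed_loopD:
  assumes "closed_loop q C n A E Zr y V"
  shows "y i t = (if i < C \<and> t < n then (A y i t + E V i t) mod q else 0)"
    and "V j t = (if j \<in> Zr \<and> t < n then A y j t mod q else 0)"
  using assms unfolding closed_loop_def by blast+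

lemma closed_loop_less:
  assumes "closed_loop q C n A E Zr y V" "q > 0"
  shows "y i t < q"
  using assms(2) by (subst closed_loopD(1)[OF assms(1)]) simp

text \<open>Agreement at the one word \<open>y\<close> suffices, so encoders that differ elsewhere
  can still be exchanged inside a run.\<close>

lemma closed_loop_cong:
  assumes "\<And>i t. i < C \<Longrightarrow> t < n \<Longrightarrow> A y i t = A' y i t" "Zr \<subseteq> {..<C}"
  shows "closed_loop q C n A E Zr y V \<longleftrightarrow> closed_loop q C n A' E Zr y V"
proof -
  have "(if i < C \<and> t < n then (A y i t + E V i t) mod q else 0)
      = (if i < C \<and> t < n then (A' y i t + E V i t) mod q else 0)" for i t
    using assms(1) by simp
  moreover have "(\<lambda>j t. if j \<in> Zr \<and> t < n then A y j t mod q else 0)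
      = (\<lambda>j t. if j \<in> Zr \<and> t < n then A' y j t mod q else 0)"
    using assms by (intro ext) auto
  ultimately show ?thesis
    unfolding closed_loop_def by simp
qed

lemma recv_outside: "\<not> (i < C \<and> t' < t) \<Longrightarrow> recv q C A E Zr t i t' = 0"
  by (induction t) (auto simp: Let_def)

lemma recv_prefix: "t' < s \<Longrightarrow> s \<le> t \<Longrightarrow> recv q C A E Zr t i t' = recv q C A E Zr s i t'"
proof (induction t)
  case (Suc t)
  then show ?case
    by (cases "s = Suc t") (auto simp: Let_def)
qed auto

text \<open>Causality allows the truncated histories and observations of the recursion to be
  replaced by the final word and view.\<close>

lemma closed_loop_recv:
  assumes A: "feedback_causal C ls A" "ls \<noteq> []" and E: "causal_jammer Zr Zw E"
  shows "closed_loop q C n A E Zr (recv q C A E Zr n) (calvin_view q C n A E Zr)"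
proof -
  let ?r = "recv q C A E Zr" and ?V = "calvin_view q C n A E Zr"
  have A_eq: "A (?r s) i t = A (?r n) i t" if "t \<le> s" "s \<le> n" for i t s
    by (rule feedback_causalD[OF A]) (use that in \<open>simp add: recv_prefix[symmetric]\<close>)
  have V: "?V = (\<lambda>j t. if j \<in> Zr \<and> t < n then A (?r n) j t mod q else 0)"
    unfolding calvin_view_def
    by (intro ext) (auto intro!: arg_cong[where f = "\<lambda>x. x mod q"] A_eq)
  have "?r n i t = (A (?r n) i t + E ?V i t) mod q" if "i < C" "t < n" for i t
  proof -
    have "?r n i t = ?r (Suc t) i t"
      by (rule recv_prefix) (use that in auto)
    also have "\<dots> = (A (?r t) i t
        + E (\<lambda>j t'. if j \<in> Zr \<and> t' \<le> t then A (?r t) j t' mod q else 0) i t) mod q"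
      using that by (simp add: Let_def)
    also have "E (\<lambda>j t'. if j \<in> Zr \<and> t' \<le> t then A (?r t) j t' mod q else 0) i t = E ?V i t"
      by (rule causal_jammerD[OF E])
        (use that in \<open>auto simp: V intro!: arg_cong[where f = "\<lambda>x. x mod q"] A_eq\<close>)
    finally show ?thesis
      using that A_eq[of t t i] by simp
  qed
  then show ?thesis
    unfolding closed_loop_def using V recv_outside by auto
qed

lemma closed_loop_unique:
  assumes A: "feedback_causal C ls A" "ls \<noteq> []" and E: "causal_jammer Zr Zw E"
    and cl: "closed_loop q C n A E Zr y V" and cl': "closed_loop q C n A E Zr y' V'"
  shows "y = y'" "V = V'"
proof -
  have "\<forall>i. y i t = y' i t" for t
  proof (induction t rule: less_induct)
    case (less t)
    \<comment> \<open>The case \<open>s = t\<close> is included because Calvin reacts to the symbols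
      of the current instant, while Alice's symbols at \<open>t\<close> read only earlier
      ones.\<close>
    have A_eq: "A y i s = A y' i s" if "s \<le> t" for i s
      by (rule feedback_causalD[OF A]) (use less that in auto)
    have "E V i t = E V' i t" for i
      by (rule causal_jammerD[OF E]) (use cl cl' A_eq in \<open>auto simp: closed_loop_def\<close>)
    then show ?case
      using cl cl' A_eq[of t] unfolding closed_loop_def by auto
  qed
  then show "y = y'"
    by (intro ext) auto
  then show "V = V'"
    using cl cl' unfolding closed_loop_def by auto
qed

lemma perfectly_secretI:
  assumes "K \<ge> 1"
    and "\<And>m. m < K \<Longrightarrow> map_pmf (\<lambda>u. calvin_view q C n (enc m u) E Zr) P = Q"
  shows "perfectly_secret q C n K P enc E Zr"
proof -
  have "bind_pmf (pmf_of_set {..<K})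
          (\<lambda>m. map_pmf (\<lambda>u. (m, calvin_view q C n (enc m u) E Zr)) P)
      = bind_pmf (pmf_of_set {..<K}) (\<lambda>m. map_pmf (Pair m) Q)"
  proof (rule bind_pmf_cong[OF refl])
    fix m assume "m \<in> set_pmf (pmf_of_set {..<K})"
    then have "m < K"
      using assms(1) by (subst (asm) set_pmf_of_set) (auto simp: lessThan_empty_iff)
    from assms(2)[OF this, symmetric]
    show "map_pmf (\<lambda>u. (m, calvin_view q C n (enc m u) E Zr)) P = map_pmf (Pair m) Q"
      by (simp add: map_pmf_comp)
  qed
  also have "\<dots> = pair_pmf (pmf_of_set {..<K}) Q"
    by (simp add: pair_pmf_def map_pmf_def)
  finally show ?thesis
    unfolding perfectly_secret_def Let_def by (simp add: map_fst_pair_pmf map_snd_pair_pmf)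
qed

text \<open>Each message has mass \<open>1 / K\<close>; cancelling it in the product law leaves the
  marginal law of the view for every message.\<close>

lemma perfectly_secretD:
  assumes "perfectly_secret q C n K P enc E Zr" "m < K" "m' < K"
  shows "map_pmf (\<lambda>u. calvin_view q C n (enc m u) E Zr) P =
         map_pmf (\<lambda>u. calvin_view q C n (enc m' u) E Zr) P"
proof -
  define D where "D = bind_pmf (pmf_of_set {..<K})
      (\<lambda>m. map_pmf (\<lambda>u. (m, calvin_view q C n (enc m u) E Zr)) P)"
  have D: "D = pair_pmf (map_pmf fst D) (map_pmf snd D)"
    using assms(1) unfolding perfectly_secret_def D_def Let_def .
  have fst: "map_pmf fst D = pmf_of_set {..<K}"
    by (simp add: D_def map_bind_pmf map_pmf_comp bind_return_pmf')
  have "pmf (map_pmf (\<lambda>u. calvin_view q C n (enc m u) E Zr) P) v = pmf (map_pmf snd D) v"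
    if m: "m < K" for m v
  proof -
    have pair: "pmf (map_pmf (\<lambda>u. (k, calvin_view q C n (enc k u) E Zr)) P) (m, v)
        = (if k = m then pmf (map_pmf (\<lambda>u. calvin_view q C n (enc m u) E Zr) P) v else 0)" for k
      by (auto simp: pmf_map vimage_def)
    have "pmf D (m, v) = pmf (map_pmf (\<lambda>u. calvin_view q C n (enc m u) E Zr) P) v / real K"
      unfolding D_def using m by (subst pmf_bind_pmf_of_set) (auto simp: pair)
    moreover have "pmf D (m, v) = pmf (map_pmf snd D) v / real K"
    proof -
      have "pmf D (m, v) = pmf (pair_pmf (map_pmf fst D) (map_pmf snd D)) (m, v)"
        using D by simp
      also have "\<dots> = pmf (map_pmf snd D) v / real K"
        unfolding pmf_pair fst using m by (subst pmf_of_set) auto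
      finally show ?thesis .
    qed
    ultimately show ?thesis
      using m by simp
  qed
  then show ?thesis
    using assms(2,3) by (intro pmf_eqI) simp
qed

section \<open>Converse\<close>

text \<open>The left side is the expected size of \<open>{x \<in> F. Q x u}\<close>. This turns
  counting for fixed private randomness into a bound on probabilities.\<close>

lemma sum_prob_le:
  fixes P :: "'a pmf"
  assumes "finite F" and "\<And>u. real (card {x \<in> F. Q x u}) \<le> c"
  shows "(\<Sum>x\<in>F. measure_pmf.prob P {u. Q x u}) \<le> c"
proof -
  have int: "integrable P (indicat_real {u. Q x u})" for x
    by (rule measure_pmf.integrable_const_bound[of _ 1]) auto
  have "(\<Sum>x\<in>F. measure_pmf.prob P {u. Q x u})
      = measure_pmf.expectation P (\<lambda>u. \<Sum>x\<in>F. indicat_real {u. Q x u} u)"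
    using int by (subst Bochner_Integration.integral_sum) auto
  also have "\<dots> \<le> c"
  proof (rule measure_pmf.integral_le_const)
    have "(\<Sum>x\<in>F. indicat_real {u. Q x u} u) = real (card {x \<in> F. Q x u})" for u
      using assms(1) by (simp add: indicator_def sum.If_cases Int_def)
    then show "AE u in P. (\<Sum>x\<in>F. indicat_real {u. Q x u} u) \<le> c"
      using assms(2) by simp
  qed (use int in auto)
  finally show ?thesis .
qed

lemma sum_prob_correct:
  assumes "K \<ge> 1"
  shows "(\<Sum>m<K. measure_pmf.prob P {u. dec (recv q C (enc m u) E Zr n) = m})
       = real K * (1 - error_prob q C n K P enc dec E Zr)"
proof -
  have "measure_pmf.prob P {u. dec (recv q C (enc m u) E Zr n) = m}
      = 1 - measure_pmf.prob P {u. dec (recv q C (enc m u) E Zr n) \<noteq> m}" for m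
    using measure_pmf.prob_compl[of "{u. dec (recv q C (enc m u) E Zr n) \<noteq> m}" P]
    by (simp add: Compl_eq_Diff_UNIV[symmetric] Collect_neg_eq[symmetric])
  then show ?thesis
    using assms by (simp add: error_prob_def sum_subtractf right_diff_distrib)
qed

text \<open>Jam with a uniformly random constant sequence on \<open>Zw\<close>. For fixed private randomness, the received
  word determines the decoded message, hence (if it is correct) all transmitted symbols, hence the
  jamming sequence; so at most \<open>q ^ (C * n)\<close> pairs (jamming, message) are decoded correctly.\<close>

lemma converse_jamming:
  assumes K: "K \<ge> 1" and q: "q \<ge> 2" and ls: "ls \<noteq> []"
    and enc: "\<And>m u. feedback_causal C ls (enc m u)"
    and Zw: "Zw \<subseteq> {..<C}"
    and err: "\<And>e. error_prob q C n K P enc dec (\<lambda>obs i t. if i \<in> Zw then e i t else 0) Zr < 1/2"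
  shows "real K < 2 * real q ^ ((C - card Zw) * n)"
proof -
  define I where "I = Zw \<times> {..<n}"
  define Es where "Es = (\<Pi>\<^sub>E x\<in>I. {..<q})"
  define Ys where "Ys = (\<Pi>\<^sub>E x\<in>{..<C} \<times> {..<n}. {..<q})"
  define J :: "(nat \<times> nat \<Rightarrow> nat) \<Rightarrow> (nat \<Rightarrow> nat \<Rightarrow> nat) \<Rightarrow> nat \<Rightarrow> nat \<Rightarrow> nat"
    where "J = (\<lambda>e obs i t. if i \<in> Zw then e (i, t) else 0)"
  define Q where "Q = (\<lambda>(e, m) u. dec (recv q C (enc m u) (J e) Zr n) = m)"
  have fin: "finite Zw"
    using Zw finite_subset by blast
  then have card_Es: "card Es = q ^ (card Zw * n)" and fin_Es: "finite Es"
    by (simp_all add: Es_def I_def card_PiE finite_PiE card_cartesian_product)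
  have card_Ys: "card Ys = q ^ (C * n)" and fin_Ys: "finite Ys"
    by (simp_all add: Ys_def card_PiE finite_PiE card_cartesian_product)
  have J: "causal_jammer Zr Zw (J e)" for e
    by (auto simp: causal_jammer_def J_def)
  have cl: "closed_loop q C n (enc m u) (J e) Zr (recv q C (enc m u) (J e) Zr n)
      (calvin_view q C n (enc m u) (J e) Zr)" for m u e
    by (rule closed_loop_recv[OF enc ls J])
  have card_le: "card {x \<in> Es \<times> {..<K}. Q x u} \<le> card Ys" for u
  proof -
    let ?G = "\<lambda>(e, m). \<lambda>(i, t)\<in>{..<C} \<times> {..<n}. recv q C (enc m u) (J e) Zr n i t"
    have "inj_on ?G {x \<in> Es \<times> {..<K}. Q x u}"
    proof (rule inj_onI)
      fix x x'
      assume x: "x \<in> {x \<in> Es \<times> {..<K}. Q x u}" and x': "x' \<in> {x \<in> Es \<times> {..<K}. Q x u}"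
        and G: "?G x = ?G x'"
      obtain e m e' m' where xx: "x = (e, m)" "x' = (e', m')"
        by (cases x, cases x')
      have e: "e \<in> Es" "e' \<in> Es" and Q: "Q (e, m) u" "Q (e', m') u"
        and eq: "?G (e, m) = ?G (e', m')"
        using x x' G unfolding xx by auto
      have y: "recv q C (enc m u) (J e) Zr n = recv q C (enc m' u) (J e') Zr n"
      proof (intro ext)
        fix i t
        show "recv q C (enc m u) (J e) Zr n i t = recv q C (enc m' u) (J e') Zr n i t"
          using fun_cong[OF eq, of "(i, t)"]
          by (cases "i < C \<and> t < n") (auto simp: recv_outside)
      qed
      then have mm: "m = m'"
        using Q by (auto simp: Q_def)
      have "e x = e' x" if xI: "x \<in> I" for x
      proof -
        obtain i t where x: "x = (i, t)" "i \<in> Zw" "i < C" "t < n"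
          using xI Zw by (auto simp: I_def)
        define y where "y = recv q C (enc m u) (J e) Zr n"
        have y': "y = recv q C (enc m u) (J e') Zr n"
          unfolding y_def using y mm by simp
        have "y i t = (enc m u y i t + e x) mod q"
          using cl[of m u e] x unfolding closed_loop_def y_def[symmetric] by (simp add: J_def)
        moreover have "y i t = (enc m u y i t + e' x) mod q"
          using cl[of m u e'] x unfolding closed_loop_def y'[symmetric] by (simp add: J_def)
        ultimately have "[enc m u y i t + e x = enc m u y i t + e' x] (mod q)"
          by (simp add: cong_def)
        then have "[e x = e' x] (mod q)"
          by (simp add: cong_add_lcancel_nat)
        moreover have "e x < q" "e' x < q"
          using e xI by (auto simp: Es_def PiE_iff)
        ultimately show ?thesis
          by (simp add: cong_def)
      qed
      then show "x = x'"
        using mm e unfolding Es_def xx by (auto intro: PiE_ext)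
    qed
    moreover have "?G ` {x \<in> Es \<times> {..<K}. Q x u} \<subseteq> Ys"
    proof -
      have "recv q C (enc m u) (J e) Zr n i t < q" for m e i t
        using closed_loop_less[OF cl] q by simp
      then show ?thesis
        unfolding Ys_def by (intro image_subsetI) (simp add: split_beta restrict_PiE_iff)
    qed
    ultimately show ?thesis
      using fin_Ys by (rule card_inj_on_le)
  qed
  have "real (card Es) * (real K / 2) = (\<Sum>e\<in>Es. real K / 2)"
    by simp
  \<comment> \<open>Every single jamming sequence leaves success probability above 1/2, so a sum
    over \<open>Es\<close> can stand for the random jammer.\<close>
  also have "\<dots> < (\<Sum>e\<in>Es. \<Sum>m<K. measure_pmf.prob P {u. dec (recv q C (enc m u) (J e) Zr n) = m})"
  proof (rule sum_strict_mono[OF fin_Es])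
    show "Es \<noteq> {}"
      using card_Es q by auto
    show "real K / 2 < (\<Sum>m<K. measure_pmf.prob P {u. dec (recv q C (enc m u) (J e) Zr n) = m})" for e
      using K err[of "\<lambda>i t. e (i, t)"] by (subst sum_prob_correct) (auto simp: J_def)
  qed
  also have "\<dots> = (\<Sum>x\<in>Es \<times> {..<K}. measure_pmf.prob P {u. Q x u})"
    by (simp add: sum.cartesian_product Q_def case_prod_unfold)
  also have "\<dots> \<le> real (card Ys)"
    by (rule sum_prob_le) (use fin_Es card_le in auto)
  also have "\<dots> = real q ^ (card Zw * n) * real q ^ ((C - card Zw) * n)"
  proof -
    have "card Zw \<le> C"
      using card_mono[OF _ Zw] by simp
    then show ?thesis
      by (simp add: card_Ys power_add[symmetric] add_mult_distrib[symmetric])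
  qed
  finally have "real q ^ (card Zw * n) * (real K / 2)
      < real q ^ (card Zw * n) * real q ^ ((C - card Zw) * n)"
    by (simp add: card_Es)
  then have "real K / 2 < real q ^ ((C - card Zw) * n)"
    by (rule mult_left_less_imp_less) simp
  then show ?thesis
    by simp
qed

text \<open>Without jamming the received word splits into the view and the remaining \<open>C - card Zr\<close> links. For
  each content of those links the decoder is a guess from the view alone, which is independent of
  the message.\<close>

lemma converse_secrecy:
  assumes K: "K \<ge> 1" and q: "q \<ge> 2" and ls: "ls \<noteq> []"
    and enc: "\<And>m u. feedback_causal C ls (enc m u)"
    and Zr: "Zr \<subseteq> {..<C}"
    and err: "error_prob q C n K P enc dec (\<lambda>_ _ _. 0) Zr < 1/2"
    and sec: "perfectly_secret q C n K P enc (\<lambda>_ _ _. 0) Zr"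
  shows "real K < 2 * real q ^ ((C - card Zr) * n)"
proof -
  define I where "I = ({..<C} - Zr) \<times> {..<n}"
  define R where "R = (\<Pi>\<^sub>E x\<in>I. {..<q})"
  let ?Y = "\<lambda>m u. recv q C (enc m u) (\<lambda>_ _ _. 0) Zr n"
  let ?V = "\<lambda>m u. calvin_view q C n (enc m u) (\<lambda>_ _ _. 0) Zr"
  define join :: "(nat \<Rightarrow> nat \<Rightarrow> nat) \<Rightarrow> (nat \<times> nat \<Rightarrow> nat) \<Rightarrow> nat \<Rightarrow> nat \<Rightarrow> nat"
    where "join = (\<lambda>v r i t. if i \<in> Zr then v i t else if i < C \<and> t < n then r (i, t) else 0)"
  have fin: "finite Zr"
    using Zr finite_subset by blast
  then have card_R: "card R = q ^ ((C - card Zr) * n)" and fin_R: "finite R"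
    using Zr by (simp_all add: R_def I_def card_PiE finite_PiE card_cartesian_product card_Diff_subset)
  have cl: "closed_loop q C n (enc m u) (\<lambda>_ _ _. 0) Zr (?Y m u) (?V m u)" for m u
    by (rule closed_loop_recv[OF enc ls, of _ "{}"]) (simp add: causal_jammer_def)
  have Y_join: "\<exists>r\<in>R. ?Y m u = join (?V m u) r" for m u
  proof
    define y where "y = ?Y m u"
    define V where "V = ?V m u"
    have y: "y i t = (if i < C \<and> t < n then enc m u y i t mod q else 0)"
      and V: "V j t = (if j \<in> Zr \<and> t < n then enc m u y j t mod q else 0)" for i j t
      using cl[of m u] unfolding closed_loop_def y_def[symmetric] V_def[symmetric] by simp_all
    show "(\<lambda>(i, t)\<in>I. y i t) \<in> R"
      unfolding R_def I_def using q by (auto simp: y PiE_iff)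
    show "?Y m u = join (?V m u) (\<lambda>(i, t)\<in>I. y i t)"
      unfolding y_def[symmetric] V_def[symmetric]
      by (intro ext) (use Zr in \<open>auto simp: join_def I_def V y\<close>)
  qed
  define Q where "Q = map_pmf (?V 0) P"
  have Q: "map_pmf (?V m) P = Q" if "m < K" for m
    unfolding Q_def by (rule perfectly_secretD[OF sec that]) (use K in simp)
  have "real K / 2 < (\<Sum>m<K. measure_pmf.prob P {u. dec (?Y m u) = m})"
    using K err by (subst sum_prob_correct) auto
  \<comment> \<open>A union bound over all contents \<open>r\<close> of the unread links frees the
    decoder from its dependence on the run: only the common view law \<open>Q\<close>
    remains.\<close>
  also have "\<dots> \<le> (\<Sum>m<K. \<Sum>r\<in>R. measure_pmf.prob Q {v. dec (join v r) = m})"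
  proof (rule sum_mono)
    fix m assume "m \<in> {..<K}"
    then have m: "m < K" by simp
    have "measure_pmf.prob P {u. dec (?Y m u) = m}
        \<le> measure_pmf.prob P (\<Union>r\<in>R. {u. dec (join (?V m u) r) = m})"
    proof (rule measure_pmf.finite_measure_mono)
      show "{u. dec (?Y m u) = m} \<subseteq> (\<Union>r\<in>R. {u. dec (join (?V m u) r) = m})"
      proof
        fix u assume "u \<in> {u. dec (?Y m u) = m}"
        with Y_join[of m u] show "u \<in> (\<Union>r\<in>R. {u. dec (join (?V m u) r) = m})"
          by (metis (mono_tags, lifting) UN_I mem_Collect_eq)
      qed
    qed simp
    also have "\<dots> \<le> (\<Sum>r\<in>R. measure_pmf.prob P {u. dec (join (?V m u) r) = m})"
      by (rule measure_pmf.finite_measure_subadditive_finite) (use fin_R in auto)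
    also have "\<dots> = (\<Sum>r\<in>R. measure_pmf.prob Q {v. dec (join v r) = m})"
      unfolding Q[OF m, symmetric] by (simp add: vimage_def)
    finally show "measure_pmf.prob P {u. dec (?Y m u) = m}
        \<le> (\<Sum>r\<in>R. measure_pmf.prob Q {v. dec (join v r) = m})" .
  qed
  also have "\<dots> = (\<Sum>r\<in>R. \<Sum>m<K. measure_pmf.prob Q {v. dec (join v r) = m})"
    by (rule sum.swap)
  also have "\<dots> \<le> (\<Sum>r\<in>R. 1)"
  proof (rule sum_mono)
    fix r
    have "card {m \<in> {..<K}. dec (join v r) = m} \<le> card {dec (join v r)}" for v
      by (rule card_mono) auto
    then show "(\<Sum>m<K. measure_pmf.prob Q {v. dec (join v r) = m}) \<le> 1"
      by (intro sum_prob_le) auto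
  qed
  finally show ?thesis
    by (simp add: card_R)
qed

text \<open>If \<open>R\<close> exceeds the bound by \<open>g\<close>, a block length
  \<open>n > 1 / g\<close> gives \<open>q powr (n * g) \<ge> q \<ge> 2\<close>, which the factor 2
  in both counting bounds cannot absorb.\<close>

lemma achievable_le:
  assumes "zrw + zro + zwo \<le> C" and ach: "achievable C zrw zro zwo R"
  shows "R \<le> real C - real (max (zrw + zro) (zrw + zwo))"
proof (rule ccontr)
  define z where "z = max (zrw + zro) (zrw + zwo)"
  define g where "g = R - (real C - real z)"
  assume "\<not> ?thesis"
  then have g: "g > 0"
    by (simp add: g_def z_def)
  have "(1/2 :: real) > 0"
    by simp
  with ach obtain N where N: "\<forall>n\<ge>N. \<exists>q K ls P enc dec.
      reliable_secret_code C zrw zro zwo R (1/2) n q K ls P enc dec"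
    unfolding achievable_iff by blast
  obtain n0 where "real n0 > 1 / g"
    using reals_Archimedean2 by blast
  then obtain n where n: "n \<ge> N" "real n > 1 / g"
    by (intro that[of "max N n0"]) auto
  obtain q K ls P enc dec
    where rsc: "reliable_secret_code C zrw zro zwo R (1/2) n q K ls P enc dec"
    using N n(1) by blast
  then have code: "q \<ge> 2" "K \<ge> 1" "real K \<ge> real q powr (real n * R)"
      "ls \<noteq> []" "\<And>m u. feedback_causal C ls (enc m u)"
    by (simp_all add: reliable_secret_code_def)
  have adv: "error_prob q C n K P enc dec E (Zrw \<union> Zro) < 1/2 \<and>
      perfectly_secret q C n K P enc E (Zrw \<union> Zro)"
    if "admissible_sets C zrw zro zwo Zrw Zro Zwo" "causal_jammer (Zrw \<union> Zro) (Zrw \<union> Zwo) E"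
    for Zrw Zro Zwo E
    using rsc that unfolding reliable_secret_code_def by blast
  \<comment> \<open>Calvin exhausts his budget on three consecutive blocks of links, which fit by
    the assumption on \<open>C\<close>.\<close>
  define Zrw where "Zrw = {..<zrw}"
  define Zro where "Zro = {zrw..<zrw+zro}"
  define Zwo where "Zwo = {zrw+zro..<zrw+zro+zwo}"
  have adm: "admissible_sets C zrw zro zwo Zrw Zro Zwo"
    using assms(1) by (auto simp: admissible_sets_def Zrw_def Zro_def Zwo_def)
  have card: "card (Zrw \<union> Zro) = zrw + zro" "card (Zrw \<union> Zwo) = zrw + zwo"
    by (subst card_Un_disjoint; auto simp: Zrw_def Zro_def Zwo_def)+
  have sub: "Zrw \<union> Zro \<subseteq> {..<C}" "Zrw \<union> Zwo \<subseteq> {..<C}"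
    using adm by (auto simp: admissible_sets_def)
  have "real K < 2 * real q ^ ((C - card (Zrw \<union> Zwo)) * n)"
  proof (rule converse_jamming[OF code(2,1,4,5) sub(2), where Zr = "Zrw \<union> Zro"])
    show "error_prob q C n K P enc dec (\<lambda>obs i t. if i \<in> Zrw \<union> Zwo then e i t else 0)
        (Zrw \<union> Zro) < 1/2" for e
      using adv[OF adm] by (auto simp: causal_jammer_def)
  qed
  moreover have "real K < 2 * real q ^ ((C - card (Zrw \<union> Zro)) * n)"
    by (rule converse_secrecy[OF code(2,1,4,5) sub(1)])
      (use adv[OF adm, of "\<lambda>_ _ _. 0"] in \<open>auto simp: causal_jammer_def\<close>)
  ultimately have "real K < 2 * real q ^ ((C - z) * n)"
    by (simp add: card z_def max_def)
  also have "real q ^ ((C - z) * n) = real q powr (real n * (real C - real z))"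
    using code(1) assms(1) by (subst powr_realpow[symmetric]) (auto simp: z_def of_nat_diff mult.commute)
  finally have "real q powr (real n * R) < 2 * real q powr (real n * (real C - real z))"
    using code(3) by linarith
  moreover have "real q powr (real n * R) = real q powr (real n * g) * real q powr (real n * (real C - real z))"
    by (simp add: g_def powr_add[symmetric] algebra_simps)
  ultimately have "real q powr (real n * g) < 2"
    using code(1) by (simp add: mult_less_cancel_right)
  moreover have "real n * g \<ge> 1"
    using n(2) g by (simp add: field_simps)
  then have "real q powr (real n * g) \<ge> real q powr 1"
    using code(1) by (intro powr_mono) auto
  ultimately show False
    using code(1) by simp
qed

section \<open>Power sums modulo a prime\<close>

text \<open>Invertibility of the Vandermonde matrix. Combining the power sums with the coefficients
  of the polynomial that vanishes on \<open>S - {i}\<close> leaves only \<open>x i\<close>, times a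
  product of differences of distinct residues, which the prime \<open>q\<close> does not
  divide.\<close>

lemma power_sums_zero_mod:
  fixes q :: nat and x :: "nat \<Rightarrow> int"
  assumes q: "prime q" and S: "finite S" "S \<subseteq> {..<q}"
    and sums: "\<And>k. k < card S \<Longrightarrow> [(\<Sum>i\<in>S. int i ^ k * x i) = 0] (mod int q)"
    and i: "i \<in> S"
  shows "[x i = 0] (mod int q)"
proof -
  define p :: "int poly" where "p = (\<Prod>j\<in>S - {i}. [:- int j, 1:])"
  have "degree p \<le> (\<Sum>j\<in>S - {i}. degree [:- int j, 1:])"
    unfolding p_def using S(1) by (intro degree_prod_sum_le[unfolded comp_def]) auto
  also have "\<dots> < card S"
    using S(1) i by (auto simp: card_gt_0_iff intro!: diff_less)
  finally have deg: "degree p < card S" .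
  have p_zero: "poly p (int j) = 0" if "j \<in> S - {i}" for j
    using S(1) that by (auto simp: p_def poly_prod)
  have "(\<Sum>j\<in>S. poly p (int j) * x j) = (\<Sum>j\<in>S. \<Sum>k\<le>degree p. coeff p k * (int j ^ k * x j))"
    by (simp add: poly_altdef sum_distrib_right mult.assoc)
  also have "\<dots> = (\<Sum>k\<le>degree p. coeff p k * (\<Sum>j\<in>S. int j ^ k * x j))"
    by (subst sum.swap) (simp add: sum_distrib_left)
  also have "[\<dots> = (\<Sum>k\<le>degree p. coeff p k * 0)] (mod int q)"
    using deg by (intro cong_sum cong_mult cong_refl sums) auto
  finally have "[(\<Sum>j\<in>S. poly p (int j) * x j) = 0] (mod int q)"
    by simp
  moreover have "(\<Sum>j\<in>S. poly p (int j) * x j) = poly p (int i) * x i"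
    using S(1) i p_zero by (subst sum.remove[of _ i]) auto
  ultimately have "int q dvd poly p (int i) * x i"
    by (simp add: cong_0_iff)
  moreover have "\<not> int q dvd poly p (int i)"
  proof
    assume "int q dvd poly p (int i)"
    then have "int q dvd (\<Prod>j\<in>S - {i}. int i - int j)"
      by (simp add: p_def poly_prod)
    then obtain j where j: "j \<in> S - {i}" "int q dvd int i - int j"
      using q S(1) by (auto simp: prime_dvd_prod_iff)
    then have "[int i = int j] (mod int q)"
      by (simp add: cong_iff_dvd_diff)
    then show False
      using j S(2) i cong_less_imp_eq_nat[of i q j] by (auto simp: cong_int_iff)
  qed
  ultimately show ?thesis
    using q by (auto simp: cong_0_iff prime_dvd_mult_iff)
qed

lemma power_sums_unique_mod:
  fixes q :: nat and x x' :: "nat \<Rightarrow> nat"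
  assumes "prime q" "finite S" "S \<subseteq> {..<q}"
    and sums: "\<And>k. k < card S \<Longrightarrow>
      [(\<Sum>i\<in>S. int i ^ k * int (x i)) = (\<Sum>i\<in>S. int i ^ k * int (x' i))] (mod int q)"
    and i: "i \<in> S"
  shows "[x i = x' i] (mod q)"
proof -
  have "[int (x i) - int (x' i) = 0] (mod int q)"
  proof (rule power_sums_zero_mod[where S = S and x = "\<lambda>i. int (x i) - int (x' i)"])
    show "[(\<Sum>i\<in>S. int i ^ k * (int (x i) - int (x' i))) = 0] (mod int q)" if "k < card S" for k
      using sums[OF that] by (simp add: right_diff_distrib sum_subtractf cong_diff_iff_cong_0)
  qed (use assms in auto)
  then show ?thesis
    by (simp add: cong_diff_iff_cong_0 cong_int_iff)
qed

text \<open>Uniqueness makes the power sum map injective between finite sets of equal size, hence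
  surjective.\<close>

lemma power_sums_solvable_mod:
  fixes q :: nat and f :: "nat \<Rightarrow> int"
  assumes "prime q" "finite S" "S \<subseteq> {..<q}"
  shows "\<exists>x :: nat \<Rightarrow> nat. (\<forall>i. x i < q) \<and> (\<forall>i. i \<notin> S \<longrightarrow> x i = 0) \<and>
      (\<forall>k<card S. [(\<Sum>i\<in>S. int i ^ k * int (x i)) = f k] (mod int q))"
proof -
  have q: "q > 0"
    using assms(1) prime_gt_0_nat by blast
  define X where "X = (\<Pi>\<^sub>E i\<in>S. {..<q})"
  define Y where "Y = (\<Pi>\<^sub>E k\<in>{..<card S}. {..<q})"
  define F where "F = (\<lambda>x. \<lambda>k\<in>{..<card S}. nat ((\<Sum>i\<in>S. int i ^ k * int (x i)) mod int q))"
  have "finite Y" "card X = card Y"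
    using assms(2) by (simp_all add: X_def Y_def card_PiE finite_PiE)
  moreover have "F ` X \<subseteq> Y"
    using q by (auto simp: F_def Y_def nat_less_iff split: if_splits)
  moreover have "inj_on F X"
  proof (rule inj_onI)
    fix x x' assume x: "x \<in> X" "x' \<in> X" and eq: "F x = F x'"
    have "[(\<Sum>i\<in>S. int i ^ k * int (x i)) = (\<Sum>i\<in>S. int i ^ k * int (x' i))] (mod int q)"
      if "k < card S" for k
      using fun_cong[OF eq, of k] that q by (simp add: F_def cong_def eq_nat_nat_iff)
    from power_sums_unique_mod[OF assms this]
    have "x i = x' i" if "i \<in> S" for i
      using that x cong_less_imp_eq_nat[of "x i" q "x' i"] by (auto simp: X_def PiE_iff)
    then show "x = x'"
      using x unfolding X_def by (intro PiE_ext) auto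
  qed
  ultimately have "F ` X = Y"
    by (metis card_image card_subset_eq)
  moreover have "(\<lambda>k\<in>{..<card S}. nat (f k mod int q)) \<in> Y"
    using q by (auto simp: Y_def nat_less_iff)
  ultimately obtain x where x: "x \<in> X" "F x = (\<lambda>k\<in>{..<card S}. nat (f k mod int q))"
    by (metis imageE)
  let ?x = "\<lambda>i. if i \<in> S then x i else 0"
  have "[(\<Sum>i\<in>S. int i ^ k * int (?x i)) = f k] (mod int q)" if "k < card S" for k
    using fun_cong[OF x(2), of k] that q by (simp add: F_def cong_def eq_nat_nat_iff)
  then show ?thesis
    using x(1) q by (intro exI[of _ ?x]) (auto simp: X_def PiE_iff)
qed

section \<open>The coding scheme\<close>

text \<open>Lets the decoder locate the slot that delivered chunk \<open>s\<close>.\<close>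

lemma rank_exists:
  fixes P :: "nat \<Rightarrow> bool"
  assumes "s < card {t. t < n \<and> P t}"
  shows "\<exists>t<n. P t \<and> card {t'. t' < t \<and> P t'} = s"
  using assms
proof (induction n)
  case (Suc n)
  show ?case
  proof (cases "s < card {t. t < n \<and> P t}")
    case True
    with Suc.IH show ?thesis
      using less_SucI by blast
  next
    case False
    have *: "{t. t < Suc n \<and> P t} = (if P n then insert n {t. t < n \<and> P t} else {t. t < n \<and> P t})"
      by (auto simp: less_Suc_eq)
    have "P n" "card {t. t < n \<and> P t} = s"
      using Suc.prems False unfolding * by (auto split: if_splits)
    then show ?thesis
      by blast
  qed
qed simp

text \<open>Each change of a growing chain of sets adds an element; this limits the slots spoiled by
  newly jammed links.\<close>

lemma card_changes_le:
  fixes J :: "nat \<Rightarrow> 'a set"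
  assumes "\<And>t. J t \<subseteq> J (Suc t)" "\<And>t. finite (J t)"
  shows "card {t. t < m \<and> J (Suc t) \<noteq> J t} \<le> card (J m)"
proof (induction m)
  case (Suc m)
  have *: "{t. t < Suc m \<and> J (Suc t) \<noteq> J t} = (if J (Suc m) \<noteq> J m
      then insert m {t. t < m \<and> J (Suc t) \<noteq> J t} else {t. t < m \<and> J (Suc t) \<noteq> J t})"
    by (auto simp: less_Suc_eq)
  show ?case
  proof (cases "J (Suc m) = J m")
    case False
    then have "card (J m) < card (J (Suc m))"
      using assms by (intro psubset_card_mono) auto
    then show ?thesis
      using Suc.IH False unfolding * by simp
  qed (use Suc.IH * in simp)
qed simp

lemma add_mod_eq_self_iff:
  fixes x e q :: nat
  assumes "x < q"
  shows "(x + e) mod q = x \<longleftrightarrow> e mod q = 0"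
proof -
  have "(x + e) mod q = x \<longleftrightarrow> [x + e = x + 0] (mod q)"
    using assms by (simp add: cong_def)
  also have "\<dots> \<longleftrightarrow> e mod q = 0"
    by (simp only: cong_add_lcancel_nat) (simp add: cong_def)
  finally show ?thesis .
qed

text \<open>The injection \<open>cd\<close> serialises a jam log, i.e. the sequence of sets of links seen jammed before
  each time; \<open>d\<close> is the number of message symbols per data slot.\<close>

locale scheme =
  fixes q n C d S :: nat and cd :: "(nat \<Rightarrow> nat set) \<Rightarrow> nat"
  assumes prime_q: "prime q" and C_less_q: "C < q" and n_ge: "4 \<le> n" and d_le: "d \<le> C"
    and cd_inj: "inj_on cd (\<Pi>\<^sub>E t\<in>{..<n}. Pow {..<C})"
    and cd_less: "cd ` (\<Pi>\<^sub>E t\<in>{..<n}. Pow {..<C}) \<subseteq> {..<S}"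
    and S_le_q: "S \<le> q"
begin

lemma q_pos: "q > 0"
  using C_less_q by simp

abbreviation "jam_logs \<equiv> (\<Pi>\<^sub>E t\<in>{..<n}. Pow {..<C})"

definition solve :: "nat set \<Rightarrow> (nat \<Rightarrow> int) \<Rightarrow> nat \<Rightarrow> nat" where
  "solve T f = (SOME x. (\<forall>i. x i < q) \<and> (\<forall>i. i \<notin> T \<longrightarrow> x i = 0) \<and>
     (\<forall>k<card T. [(\<Sum>i\<in>T. int i ^ k * int (x i)) = f k] (mod int q)))"

lemma solve:
  assumes "T \<subseteq> {..<C}"
  shows "solve T f i < q" "i \<notin> T \<Longrightarrow> solve T f i = 0"
    "k < card T \<Longrightarrow> [(\<Sum>i\<in>T. int i ^ k * int (solve T f i)) = f k] (mod int q)"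
proof -
  have "finite T" "T \<subseteq> {..<q}"
    using assms C_less_q finite_subset by auto
  from someI_ex[OF power_sums_solvable_mod[OF prime_q this, of f], folded solve_def]
  show "solve T f i < q" "i \<notin> T \<Longrightarrow> solve T f i = 0"
    "k < card T \<Longrightarrow> [(\<Sum>i\<in>T. int i ^ k * int (solve T f i)) = f k] (mod int q)"
    by blast+
qed

text \<open>\<open>J t\<close> is the set of links seen jammed before time \<open>t\<close>. In a data slot the links of
  \<open>J t = J (t - 1)\<close> already carried fresh noise in the previous slot; what Bob received there
  serves as a shared secret.\<close>

definition data_slot :: "(nat \<Rightarrow> nat set) \<Rightarrow> nat \<Rightarrow> bool" where
  "data_slot J t \<longleftrightarrow> 3 \<le> t \<and> Suc t < n \<and> J t = J (t - 1)"

definition success :: "(nat \<Rightarrow> nat set) \<Rightarrow> nat \<Rightarrow> bool" where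
  "success J t \<longleftrightarrow> data_slot J t \<and> J (Suc t) = J t"

text \<open>Advances only after a successful slot, so that a chunk spoiled by a newly jammed link is
  sent again.\<close>

definition chunk :: "(nat \<Rightarrow> nat set) \<Rightarrow> nat \<Rightarrow> nat" where
  "chunk J t = card {t'. t' < t \<and> success J t'}"

text \<open>The choice depends on the jam history alone, so two runs with the same history have the
  same pivots.\<close>

definition pivots :: "(nat \<Rightarrow> nat set) \<Rightarrow> nat \<Rightarrow> nat set" where
  "pivots J t = (SOME T. T \<subseteq> {..<C} - J t \<and> card T = d)"

text \<open>Summing over all links ensures that some link unknown to Calvin contributes. Received
  symbols are used because Alice and Bob agree on them even under jamming.\<close>

definition key :: "(nat \<Rightarrow> nat \<Rightarrow> nat) \<Rightarrow> nat \<Rightarrow> nat" where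
  "key y t = (\<Sum>i<C. y i t)"

text \<open>In a data slot let \<open>c j\<close> be the symbol sent on \<open>j\<close> if \<open>j \<notin> J t\<close> and the symbol received in the
  previous slot on \<open>j\<close> if \<open>j \<in> J t\<close>. The symbols on the pivots are solved for so that the \<open>k\<close>-th
  power sum of \<open>c\<close> with nodes \<open>j\<close> is the \<open>k\<close>-th symbol of the current chunk. The last slot sends
  the jam log encrypted and authenticated by the affine one-time key received in slots 0 and 1.\<close>

definition free_symbol ::
  "(nat \<times> nat \<Rightarrow> nat) \<Rightarrow> (nat \<Rightarrow> nat set) \<Rightarrow> (nat \<Rightarrow> nat \<Rightarrow> nat) \<Rightarrow> nat \<Rightarrow> nat \<Rightarrow> nat" where
  "free_symbol W J y t j = (if j \<in> J t then y j (t - 1) else W (t, j))"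

definition send ::
  "(nat \<times> nat \<Rightarrow> nat) \<Rightarrow> (nat \<times> nat \<Rightarrow> nat) \<Rightarrow> (nat \<Rightarrow> nat set) \<Rightarrow> (nat \<Rightarrow> nat \<Rightarrow> nat) \<Rightarrow>
   nat \<Rightarrow> nat \<Rightarrow> nat" where
  "send M W J y i t =
    (if Suc t = n then (key y 0 * cd (restrict J {..<n}) + key y 1) mod q
     else if data_slot J t \<and> i \<in> pivots J t then
       solve (pivots J t) (\<lambda>k. int (M (chunk J t, k)) -
         (\<Sum>j\<in>{..<C} - pivots J t. int j ^ k * int (free_symbol W J y t j))) i mod q
     else W (t, i) mod q)"

section \<open>Causality of the encoder\<close>

lemma send_less: "send M W J y i t < q"
  using q_pos by (simp add: send_def)

lemma success_cong:
  assumes "\<And>t'. t' \<le> Suc t \<Longrightarrow> J t' = J' t'"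
  shows "success J t = success J' t"
  using assms by (simp add: success_def data_slot_def)

text \<open>Although \<open>success\<close> looks one slot ahead, only slots before \<open>t\<close>
  are counted, so nothing after \<open>J t\<close> enters.\<close>

lemma chunk_cong:
  assumes "\<And>t'. t' \<le> t \<Longrightarrow> J t' = J' t'"
  shows "chunk J t = chunk J' t"
proof -
  have "success J t' = success J' t'" if "t' < t" for t'
    by (rule success_cong) (use that assms in auto)
  then show ?thesis
    unfolding chunk_def by (intro arg_cong[of _ _ card]) auto
qed

lemma send_cong:
  assumes J: "\<And>t'. t' \<le> t \<Longrightarrow> J t' = J' t'"
    and y: "\<And>j t'. j < C \<Longrightarrow> t' < t \<Longrightarrow> y j t' = y' j t'"
  shows "send M W J y i t = send M W J' y' i t"
proof -
  have data: "data_slot J t = data_slot J' t"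
    using J by (simp add: data_slot_def)
  have piv: "pivots J t = pivots J' t"
    using J by (simp add: pivots_def)
  have ch: "chunk J t = chunk J' t"
    using J by (rule chunk_cong)
  show ?thesis
  proof (cases "Suc t = n")
    case True
    have "restrict J {..<n} = restrict J' {..<n}"
      using J True by (intro restrict_ext) auto
    moreover have "key y 0 = key y' 0" "key y 1 = key y' 1"
      using y True n_ge by (auto simp: key_def intro!: sum.cong)
    ultimately show ?thesis
      using True by (simp add: send_def)
  next
    case False
    have "free_symbol W J y t j = free_symbol W J' y' t j" if "data_slot J t" "j < C" for j
      using that J y by (auto simp: free_symbol_def data_slot_def)
    then have "(\<Sum>j\<in>{..<C} - pivots J t. int j ^ k * int (free_symbol W J y t j))
        = (\<Sum>j\<in>{..<C} - pivots J t. int j ^ k * int (free_symbol W J' y' t j))"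
      if "data_slot J t" for k
      using that by (intro sum.cong) auto
    then show ?thesis
      using False by (simp add: send_def data[symmetric] piv[symmetric] ch[symmetric] cong: conj_cong)
  qed
qed

text \<open>Alice's own reconstruction of the jam history: she compares what Bob received with what
  she sent. Stage \<open>t\<close> is meaningful at arguments up to \<open>t\<close> only.\<close>

primrec hist ::
  "(nat \<times> nat \<Rightarrow> nat) \<Rightarrow> (nat \<times> nat \<Rightarrow> nat) \<Rightarrow> (nat \<Rightarrow> nat \<Rightarrow> nat) \<Rightarrow> nat \<Rightarrow> nat \<Rightarrow> nat set" where
  "hist M W y 0 = (\<lambda>_. {})"
| "hist M W y (Suc t) = (hist M W y t)
     (Suc t := hist M W y t t \<union> {i. i < C \<and> y i t \<noteq> send M W (hist M W y t) y i t})"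

definition alice ::
  "(nat \<times> nat \<Rightarrow> nat) \<Rightarrow> (nat \<times> nat \<Rightarrow> nat) \<Rightarrow> (nat \<Rightarrow> nat \<Rightarrow> nat) \<Rightarrow> nat \<Rightarrow> nat \<Rightarrow> nat" where
  "alice M W y i t = (if i < C \<and> t < n then send M W (hist M W y t) y i t else 0)"

lemma hist_cong:
  assumes "\<And>j t'. j < C \<Longrightarrow> t' < t \<Longrightarrow> y j t' = y' j t'"
  shows "hist M W y t = hist M W y' t"
  using assms
proof (induction t)
  case (Suc t)
  then have h: "hist M W y t = hist M W y' t"
    by simp
  have "send M W (hist M W y t) y i t = send M W (hist M W y' t) y' i t" for i
    by (rule send_cong) (use Suc.prems h in auto)
  then have "{i. i < C \<and> y i t \<noteq> send M W (hist M W y t) y i t}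
      = {i. i < C \<and> y' i t \<noteq> send M W (hist M W y' t) y' i t}"
    using Suc.prems by auto
  then show ?case
    by (simp add: h)
qed simp

text \<open>Rounds of length one provide feedback on every earlier slot.\<close>

lemma round_start_replicate:
  assumes "t < n"
  shows "t \<le> round_start (replicate n 1) t"
proof -
  let ?A = "{sum_list (take k (replicate n (1::nat))) | k. k < length (replicate n (1::nat)) \<and>
      sum_list (take k (replicate n 1)) \<le> t}"
  have "finite ?A"
    by (rule finite_subset[of _ "{..t}"]) auto
  moreover have "t \<in> ?A"
    using assms by (intro CollectI exI[of _ t]) (simp add: sum_list_replicate)
  ultimately show ?thesis
    unfolding round_start_def by (rule Max_ge)
qed

lemma feedback_causal_alice: "feedback_causal C (replicate n 1) (alice M W)"
  unfolding feedback_causal_def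
proof (intro allI impI)
  fix y y' :: "nat \<Rightarrow> nat \<Rightarrow> nat" and i t
  assume eq: "\<forall>j<C. \<forall>t'<round_start (replicate n 1) t. y j t' = y' j t'"
  show "alice M W y i t = alice M W y' i t"
  proof (cases "t < n")
    case True
    have y: "y j t' = y' j t'" if "j < C" "t' < t" for j t'
      using eq that round_start_replicate[OF True] by auto
    have "hist M W y t = hist M W y' t"
      using y by (rule hist_cong)
    then show ?thesis
      unfolding alice_def using send_cong[of t "hist M W y t" "hist M W y' t" y y'] y by auto
  qed (simp add: alice_def)
qed

text \<open>Reduction modulo \<open>q\<close> matters: adding a multiple of \<open>q\<close> leaves
  the symbol unchanged and is not seen as jamming.\<close>

definition jammed :: "(nat \<Rightarrow> nat \<Rightarrow> nat) \<Rightarrow> nat \<Rightarrow> nat set" where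
  "jammed e t = {i. i < C \<and> (\<exists>t'<t. e i t' mod q \<noteq> 0)}"

text \<open>By induction over time, the history Alice reconstructs is the true one. The disjunction
  in the assumption on \<open>x\<close> lets one induction serve both directions of
  \<open>closed_loop_send\<close>.\<close>

lemma alice_eq_send:
  assumes y: "\<And>i t. i < C \<Longrightarrow> t < n \<Longrightarrow> y i t = (x i t + e i t) mod q"
    and x: "\<And>i t. i < C \<Longrightarrow> t < n \<Longrightarrow>
      x i t = alice M W y i t \<or> x i t = send M W (jammed e) y i t"
    and "i < C" "t < n"
  shows "alice M W y i t = send M W (jammed e) y i t"
proof -
  have hist: "hist M W y t t' = jammed e t'" if "t \<le> n" "t' \<le> t" for t t'
    using that
  proof (induction t arbitrary: t')
    case (Suc t)
    show ?case
    proof (cases "t' = Suc t")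
      case True
      have IH: "hist M W y t t' = jammed e t'" if "t' \<le> t" for t'
        using Suc that by simp
      have s: "send M W (hist M W y t) y i t = send M W (jammed e) y i t" for i
        by (rule send_cong) (use IH in auto)
      have "y i t \<noteq> send M W (hist M W y t) y i t \<longleftrightarrow> e i t mod q \<noteq> 0" if "i < C" for i
      proof -
        have "x i t = send M W (hist M W y t) y i t"
          using x[of i t] that Suc.prems s by (auto simp: alice_def)
        then show ?thesis
          using y[of i t] that Suc.prems add_mod_eq_self_iff[OF send_less] by auto
      qed
      then have "{i. i < C \<and> y i t \<noteq> send M W (hist M W y t) y i t} = {i. i < C \<and> e i t mod q \<noteq> 0}"
        by auto
      then show ?thesis
        using IH[of t] True by (auto simp: jammed_def less_Suc_eq)
    qed (use Suc in auto)
  qed (simp add: jammed_def)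
  have "send M W (hist M W y t) y i t = send M W (jammed e) y i t"
    by (rule send_cong) (use hist assms in auto)
  then show ?thesis
    using assms by (simp add: alice_def)
qed

text \<open>Replaces the reconstructed history by \<open>jammed (E V)\<close>, a function of the
  view alone; a change of noise that preserves the view then preserves the history too.\<close>

lemma closed_loop_send:
  assumes Zr: "Zr \<subseteq> {..<C}"
  shows "closed_loop q C n (alice M W) E Zr y V \<longleftrightarrow>
     closed_loop q C n (send M W (jammed (E V))) E Zr y V" (is "?A \<longleftrightarrow> ?B")
proof -
  have iff: "?A \<longleftrightarrow> ?B" if "\<And>i t. i < C \<Longrightarrow> t < n \<Longrightarrow> alice M W y i t = send M W (jammed (E V)) y i t"
    using that Zr by (rule closed_loop_cong[where A = "alice M W" and A' = "send M W (jammed (E V))"])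
  show ?thesis
  proof
    assume cl: ?A
    have "y i t = (alice M W y i t + E V i t) mod q" if "i < C" "t < n" for i t
      using closed_loopD(1)[OF cl, of i t] that by simp
    with cl show ?B
      by (subst iff[symmetric]) (auto intro!: alice_eq_send[where x = "alice M W y"])
  next
    assume cl: ?B
    have "y i t = (send M W (jammed (E V)) y i t + E V i t) mod q" if "i < C" "t < n" for i t
      using closed_loopD(1)[OF cl, of i t] that by simp
    with cl show ?A
      by (subst iff) (auto intro!: alice_eq_send[where x = "send M W (jammed (E V)) y"])
  qed
qed

end

section \<open>The view-preserving coupling\<close>

locale attacked_scheme = scheme +
  fixes Zr Zw :: "nat set" and E :: "(nat \<Rightarrow> nat \<Rightarrow> nat) \<Rightarrow> nat \<Rightarrow> nat \<Rightarrow> nat"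
  assumes Zr: "Zr \<subseteq> {..<C}" "card Zr \<le> C - d" and Zw: "Zw \<subseteq> {..<C}" "card Zw \<le> C - d"
    and d_pos: "0 < d" and E: "causal_jammer Zr Zw E"
begin

section \<open>Room on unjammed and on unread links\<close>

lemma no_jamming: "i \<notin> Zw \<Longrightarrow> E V i t = 0"
  using E unfolding causal_jammer_def by blast

lemma jammed_subset: "jammed (E V) t \<subseteq> Zw"
proof
  fix i assume "i \<in> jammed (E V) t"
  then obtain t' where "E V i t' mod q \<noteq> 0"
    by (auto simp: jammed_def)
  then show "i \<in> Zw"
    using no_jamming by (metis mod_0)
qed

lemma jammed_subset_links: "jammed (E V) t \<subseteq> {..<C}"
  by (auto simp: jammed_def)

lemma finite_links: "finite Zr" "finite Zw"
  using Zr Zw finite_subset by blast+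

lemma pivots: "pivots (jammed (E V)) t \<subseteq> {..<C} - jammed (E V) t" "card (pivots (jammed (E V)) t) = d"
proof -
  have "card (jammed (E V) t) \<le> C - d"
    using card_mono[OF finite_links(2) jammed_subset, of V t] Zw(2) by simp
  then have "d \<le> card ({..<C} - jammed (E V) t)"
    using d_le jammed_subset_links[of V t] finite_subset[OF jammed_subset_links, of V t]
    by (simp add: card_Diff_subset)
  then have "\<exists>T. T \<subseteq> {..<C} - jammed (E V) t \<and> card T = d"
    by (meson obtain_subset_with_card_n)
  from someI_ex[OF this, folded pivots_def]
  show "pivots (jammed (E V)) t \<subseteq> {..<C} - jammed (E V) t" "card (pivots (jammed (E V)) t) = d"
    by auto
qed

text \<open>As many links as there are symbols in a chunk, so that a change invisible to Calvin can
  realise every change of the chunk.\<close>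

definition unread :: "nat set" where
  "unread = (SOME T. T \<subseteq> {..<C} - Zr \<and> card T = d)"

lemma unread: "unread \<subseteq> {..<C} - Zr" "card unread = d"
proof -
  have "d \<le> card ({..<C} - Zr)"
    using d_le Zr finite_links by (simp add: card_Diff_subset)
  then have "\<exists>T. T \<subseteq> {..<C} - Zr \<and> card T = d"
    by (meson obtain_subset_with_card_n)
  from someI_ex[OF this, folded unread_def]
  show "unread \<subseteq> {..<C} - Zr" "card unread = d"
    by auto
qed

definition key_link :: nat where
  "key_link = (SOME j. j \<in> unread)"

lemma key_link: "key_link < C" "key_link \<notin> Zr"
proof -
  have "\<exists>j. j \<in> unread"
    using unread(2) d_pos by (metis card.empty ex_in_conv less_numeral_extra(3))
  from someI_ex[OF this, folded key_link_def] show "key_link < C" "key_link \<notin> Zr"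
    using unread(1) by auto
qed

definition chunk_shift ::
  "(nat \<times> nat \<Rightarrow> nat) \<Rightarrow> (nat \<times> nat \<Rightarrow> nat) \<Rightarrow> (nat \<Rightarrow> nat \<Rightarrow> nat) \<Rightarrow> nat \<Rightarrow> nat \<Rightarrow> nat" where
  "chunk_shift M M' V t = solve unread
     (\<lambda>k. int (M' (chunk (jammed (E V)) t, k)) - int (M (chunk (jammed (E V)) t, k)))"

lemma chunk_shift_Zr: "i \<in> Zr \<Longrightarrow> chunk_shift M M' V t i = 0"
  unfolding chunk_shift_def using unread(1) by (intro solve(2)) auto

lemma chunk_shift_sum:
  assumes "k < d"
  shows "[(\<Sum>j<C. int j ^ k * int (chunk_shift M M' V t j))
    = int (M' (chunk (jammed (E V)) t, k)) - int (M (chunk (jammed (E V)) t, k))] (mod int q)"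
proof -
  have sub: "unread \<subseteq> {..<C}"
    using unread(1) by auto
  have "(\<Sum>j<C. int j ^ k * int (chunk_shift M M' V t j))
      = (\<Sum>j\<in>unread. int j ^ k * int (chunk_shift M M' V t j))"
    by (rule sum.mono_neutral_right) (use sub in \<open>auto simp: chunk_shift_def solve(2)\<close>)
  then show ?thesis
    using solve(3)[OF sub] assms unread(2) by (simp add: chunk_shift_def)
qed

text \<open>The change of Alice's noise that turns message \<open>M\<close> into \<open>M'\<close> and adds \<open>g\<close> to the multiplicative key,
  invisibly for Calvin. The first summand acts on the links still good in a data slot, the second
  on the noise that becomes a shared secret in the next slot; the factor \<open>q - 1\<close> stands for \<open>-1\<close> and
  compensates \<open>g\<close> in the last slot.\<close>

definition shift ::
  "(nat \<times> nat \<Rightarrow> nat) \<Rightarrow> (nat \<times> nat \<Rightarrow> nat) \<Rightarrow> nat \<Rightarrow> (nat \<Rightarrow> nat \<Rightarrow> nat) \<Rightarrow> nat \<Rightarrow> nat \<Rightarrow> nat" where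
  "shift M M' g V t i =
     (if data_slot (jammed (E V)) t \<and> i \<notin> jammed (E V) t then chunk_shift M M' V t i else 0) +
     (if data_slot (jammed (E V)) (Suc t) \<and> i \<in> jammed (E V) (Suc t)
      then chunk_shift M M' V (Suc t) i else 0) +
     (if t = 0 \<and> i = key_link then g else 0) +
     (if t = 1 \<and> i = key_link then (q - 1) * (g * cd (restrict (jammed (E V)) {..<n})) else 0)"

lemma shift_Zr: "i \<in> Zr \<Longrightarrow> shift M M' g V t i = 0"
  using key_link by (auto simp: shift_def chunk_shift_Zr)

lemma data_slotD:
  assumes "data_slot J t"
  shows "3 \<le> t" "Suc t < n" "J t = J (t - 1)"
  using assms by (simp_all add: data_slot_def)

text \<open>The chunk terms do not overlap: if \<open>Suc t\<close> is also a data slot, its jammed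
  set equals that at \<open>t\<close>, so a good link is still good there.\<close>

lemma shift_data:
  assumes "data_slot (jammed (E V)) t" "i \<notin> jammed (E V) t"
  shows "shift M M' g V t i = chunk_shift M M' V t i"
  using assms data_slotD(1)[OF assms(1)] data_slotD(3)[of "jammed (E V)" "Suc t"]
  by (auto simp: shift_def)

lemma shift_before_data:
  assumes "data_slot (jammed (E V)) t" "i \<in> jammed (E V) t"
  shows "shift M M' g V (t - 1) i = chunk_shift M M' V t i"
proof -
  have "Suc (t - 1) = t" "t - 1 \<noteq> 0" "t - 1 \<noteq> 1"
    using data_slotD(1)[OF assms(1)] by auto
  moreover have "i \<in> jammed (E V) (t - 1)"
    using data_slotD(3)[OF assms(1)] assms(2) by simp
  ultimately show ?thesis
    using assms unfolding shift_def by simp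
qed

text \<open>Data slots begin at 3, so neither the key slots 0 and 1 nor their successors are data
  slots and no chunk term appears.\<close>

lemma shift_0: "shift M M' g V 0 i = (if i = key_link then g else 0)"
  and shift_1: "shift M M' g V 1 i =
    (if i = key_link then (q - 1) * (g * cd (restrict (jammed (E V)) {..<n})) else 0)"
  using data_slotD(1)[of "jammed (E V)"] unfolding shift_def by fastforce+

lemma shift_last: "Suc t = n \<Longrightarrow> shift M M' g V t i = 0"
  using n_ge data_slotD(2)[of "jammed (E V)"] unfolding shift_def by fastforce

definition shift_noise ::
  "(nat \<times> nat \<Rightarrow> nat) \<Rightarrow> (nat \<times> nat \<Rightarrow> nat) \<Rightarrow> nat \<Rightarrow> (nat \<Rightarrow> nat \<Rightarrow> nat) \<Rightarrow>
   (nat \<times> nat \<Rightarrow> nat) \<Rightarrow> nat \<times> nat \<Rightarrow> nat" where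
  "shift_noise M M' g V W = (\<lambda>(t, i)\<in>{..<n} \<times> {..<C}. (W (t, i) + shift M M' g V t i) mod q)"

definition shift_word ::
  "(nat \<times> nat \<Rightarrow> nat) \<Rightarrow> (nat \<times> nat \<Rightarrow> nat) \<Rightarrow> nat \<Rightarrow> (nat \<Rightarrow> nat \<Rightarrow> nat) \<Rightarrow>
   (nat \<Rightarrow> nat \<Rightarrow> nat) \<Rightarrow> nat \<Rightarrow> nat \<Rightarrow> nat" where
  "shift_word M M' g V y i t = (if i < C \<and> t < n then (y i t + shift M M' g V t i) mod q else 0)"

lemma key_shift_word:
  assumes "t < n"
  shows "[key (shift_word M M' g V y) t = key y t + (\<Sum>i<C. shift M M' g V t i)] (mod q)"
proof -
  have "[key (shift_word M M' g V y) t = (\<Sum>i<C. y i t + shift M M' g V t i)] (mod q)"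
    unfolding key_def by (rule cong_sum) (use assms in \<open>simp add: shift_word_def cong_def\<close>)
  then show ?thesis
    by (simp add: key_def sum.distrib)
qed

lemma key_0_shift_word: "[key (shift_word M M' g V y) 0 = key y 0 + g] (mod q)"
  using key_shift_word[of 0 M M' g V y] n_ge key_link by (simp add: shift_0)

text \<open>The pivots close exactly the gap left by the free symbols: \<open>d\<close> unknowns for
  \<open>d\<close> sums. Both the coupling and the decoder rest on this identity.\<close>

lemma power_sum_send:
  assumes data: "data_slot (jammed (E V)) t" and k: "k < d"
  shows "[(\<Sum>j<C. int j ^ k * int (if j \<in> jammed (E V) t then y j (t - 1)
        else if j \<in> pivots (jammed (E V)) t then send M W (jammed (E V)) y j t else W (t, j)))
    = int (M (chunk (jammed (E V)) t, k))] (mod int q)" (is "[?l = ?m] (mod _)")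
proof -
  let ?J = "jammed (E V)"
  let ?T = "pivots ?J t"
  define f where "f = (\<lambda>k. int (M (chunk ?J t, k)) -
         (\<Sum>j\<in>{..<C} - ?T. int j ^ k * int (free_symbol W ?J y t j)))"
  have T: "?T \<subseteq> {..<C}" "finite ?T" "card ?T = d"
    using pivots[of V t] finite_subset[of ?T "{..<C}"] by auto
  have "Suc t \<noteq> n"
    using data by (simp add: data_slot_def)
  then have s: "send M W ?J y j t = solve ?T f j" if "j \<in> ?T" for j
    using data that solve(1)[OF T(1)] unfolding send_def f_def by simp
  define r where "r = (\<Sum>j\<in>{..<C} - ?T. int j ^ k * int (free_symbol W ?J y t j))"
  have l: "?l = r + (\<Sum>j\<in>?T. int j ^ k * int (solve ?T f j))"
    unfolding r_def sum.subset_diff[OF T(1) finite_lessThan]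
    by (intro arg_cong2[of _ _ _ _ "(+)"] sum.cong)
      (use pivots(1)[of V t] s in \<open>auto simp: free_symbol_def\<close>)
  have m: "?m = r + f k"
    by (simp add: f_def r_def)
  show ?thesis
    unfolding l m using solve(3)[OF T(1)] k T(3) by (intro cong_add cong_refl) auto
qed

text \<open>Heart of the coupling: for a fixed jam history the encoder commutes with the shift. On
  pivots both sides have the same \<open>d\<close> power sums and agree by uniqueness; elsewhere the
  claim is direct.\<close>

lemma send_shift:
  assumes i: "i < C" and t: "t < n"
  shows "send M' (shift_noise M M' g V W) (jammed (E V)) (shift_word M M' g V y) i t
    = (send M W (jammed (E V)) y i t + shift M M' g V t i) mod q" (is "?s' i = (?s i + _) mod q")
proof -
  let ?J = "jammed (E V)"
  let ?T = "pivots ?J t"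
  let ?W' = "shift_noise M M' g V W" and ?y' = "shift_word M M' g V y"
  consider "Suc t = n" | "data_slot ?J t" "i \<in> ?T" "Suc t \<noteq> n"
    | "Suc t \<noteq> n" "\<not> (data_slot ?J t \<and> i \<in> ?T)"
    by blast
  then show ?thesis
  proof cases
    case 1
    define c where "c = cd (restrict ?J {..<n})"
    have "[key ?y' 1 = key y 1 + (q - 1) * (g * c)] (mod q)"
      using key_shift_word[of 1 M M' g V y] n_ge key_link by (simp add: shift_1[simplified] c_def)
    then have "[key ?y' 0 * c + key ?y' 1 = (key y 0 + g) * c + (key y 1 + (q - 1) * (g * c))] (mod q)"
      by (intro cong_add cong_mult cong_refl key_0_shift_word)
    \<comment> \<open>The term \<open>g * c\<close> produced by rotating the multiplicative key
      cancels modulo \<open>q\<close> against the shift of the additive key.\<close>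
    also have "(key y 0 + g) * c + (key y 1 + (q - 1) * (g * c)) = key y 0 * c + key y 1 + q * (g * c)"
    proof -
      have "g * c + (q - 1) * (g * c) = q * (g * c)"
        using q_pos by (cases q) auto
      then show ?thesis
        by (simp add: algebra_simps)
    qed
    also have "[\<dots> = key y 0 * c + key y 1] (mod q)"
      by (simp add: cong_def)
    finally show ?thesis
      using 1 by (simp add: send_def c_def cong_def shift_last)
  next
    case 2
    note data = 2(1)
    have tt: "t - 1 < n"
      using t by simp
    have T: "?T \<subseteq> {..<C}" "finite ?T" "card ?T = d" "?T \<inter> ?J t = {}"
      using pivots[of V t] finite_subset[of ?T "{..<C}"] by auto
    let ?c = "\<lambda>M W y j. if j \<in> ?J t then y j (t - 1)
        else if j \<in> ?T then send M W ?J y j t else W (t, j)"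
    let ?d = "chunk_shift M M' V t"
    \<comment> \<open>On links already jammed Alice reuses what Bob received one slot earlier, which
      was shifted by the same amount; on the other non-pivots her fresh noise is shifted.\<close>
    have outside: "[?c M' ?W' ?y' j = ?c M W y j + ?d j] (mod q)" if "j < C" "j \<notin> ?T" for j
      using that t tt shift_data[OF data, of j M M' g] shift_before_data[OF data, of j M M' g]
      by (auto simp: shift_word_def shift_noise_def cong_def)
    have sums: "[(\<Sum>j\<in>?T. int j ^ k * int (?s' j)) = (\<Sum>j\<in>?T. int j ^ k * int (?s j + ?d j))] (mod int q)"
      if "k < card ?T" for k
    proof -
      have k: "k < d"
        using that T by simp
      have split: "(\<Sum>j<C. int j ^ k * int (?c M W y j))
          = (\<Sum>j\<in>{..<C} - ?T. int j ^ k * int (?c M W y j)) + (\<Sum>j\<in>?T. int j ^ k * int (send M W ?J y j t))"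
        for M W y
        unfolding sum.subset_diff[OF T(1) finite_lessThan]
        by (intro arg_cong2[of _ _ _ _ "(+)"] sum.cong) (use T(4) in auto)
      have splitd: "(\<Sum>j<C. int j ^ k * int (?d j))
          = (\<Sum>j\<in>{..<C} - ?T. int j ^ k * int (?d j)) + (\<Sum>j\<in>?T. int j ^ k * int (?d j))"
        by (rule sum.subset_diff[OF T(1) finite_lessThan])
      have out: "[(\<Sum>j\<in>{..<C} - ?T. int j ^ k * int (?c M' ?W' ?y' j))
          = (\<Sum>j\<in>{..<C} - ?T. int j ^ k * int (?c M W y j + ?d j))] (mod int q)"
        by (intro cong_sum cong_mult cong_refl) (use outside in \<open>auto simp only: cong_int_iff Diff_iff lessThan_iff\<close>)
      have "[(\<Sum>j<C. int j ^ k * int (?c M' ?W' ?y' j))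
          = (\<Sum>j<C. int j ^ k * int (?c M W y j)) + (\<Sum>j<C. int j ^ k * int (?d j))] (mod int q)"
      proof -
        have "[(\<Sum>j<C. int j ^ k * int (?c M W y j)) + (\<Sum>j<C. int j ^ k * int (?d j))
            = int (M (chunk ?J t, k)) + (int (M' (chunk ?J t, k)) - int (M (chunk ?J t, k)))] (mod int q)"
          by (intro cong_add power_sum_send[OF data k] chunk_shift_sum k)
        then have "[(\<Sum>j<C. int j ^ k * int (?c M W y j)) + (\<Sum>j<C. int j ^ k * int (?d j))
            = int (M' (chunk ?J t, k))] (mod int q)"
          by simp
        with power_sum_send[OF data k, where M = M' and W = ?W' and y = ?y'] show ?thesis
          using cong_trans cong_sym by blast
      qed
      moreover define a where "a = (\<Sum>j\<in>{..<C} - ?T. int j ^ k * int (?c M' ?W' ?y' j))"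
      moreover define b where "b = (\<Sum>j\<in>{..<C} - ?T. int j ^ k * int (?c M W y j))"
      moreover define c where "c = (\<Sum>j\<in>{..<C} - ?T. int j ^ k * int (?d j))"
      ultimately have "[a + (\<Sum>j\<in>?T. int j ^ k * int (?s' j))
          = b + (\<Sum>j\<in>?T. int j ^ k * int (?s j)) + (c + (\<Sum>j\<in>?T. int j ^ k * int (?d j)))] (mod int q)"
        unfolding split splitd by simp
      moreover have "[a = b + c] (mod int q)"
        using out unfolding a_def b_def c_def by (simp add: distrib_left sum.distrib)
      ultimately have "[(\<Sum>j\<in>?T. int j ^ k * int (?s' j))
          = (\<Sum>j\<in>?T. int j ^ k * int (?s j)) + (\<Sum>j\<in>?T. int j ^ k * int (?d j))] (mod int q)"
      proof -
        assume 1: "[a + (\<Sum>j\<in>?T. int j ^ k * int (?s' j))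
          = b + (\<Sum>j\<in>?T. int j ^ k * int (?s j)) + (c + (\<Sum>j\<in>?T. int j ^ k * int (?d j)))] (mod int q)"
          and 2: "[a = b + c] (mod int q)"
        from cong_diff[OF 1 2] show ?thesis
          by simp
      qed
      then show ?thesis
        by (simp add: distrib_left sum.distrib)
    qed
    have "?T \<subseteq> {..<q}"
      using T(1) C_less_q by auto
    from power_sums_unique_mod[OF prime_q T(2) this sums 2(2)]
    have "[?s' i = ?s i + ?d i] (mod q)" .
    moreover have "shift M M' g V t i = ?d i"
      using T(4) 2 by (intro shift_data) auto
    ultimately show ?thesis
      using send_less by (simp add: cong_def)
  next
    case 3
    then show ?thesis
      using i t by (auto simp: send_def shift_noise_def mod_simps)
  qed
qed

text \<open>The shift vanishes on \<open>Zr\<close>, so the view and hence the response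
  \<open>E V\<close> stay the same; since jamming is additive, the shift passes through it to
  Bob.\<close>

lemma closed_loop_shift:
  assumes cl: "closed_loop q C n (alice M W) E Zr y V"
  shows "closed_loop q C n (alice M' (shift_noise M M' g V W)) E Zr (shift_word M M' g V y) V"
proof -
  have cl': "closed_loop q C n (send M W (jammed (E V))) E Zr y V"
    using cl closed_loop_send[OF Zr(1)] by blast
  let ?s' = "send M' (shift_noise M M' g V W) (jammed (E V))"
  have "shift_word M M' g V y i t = (if i < C \<and> t < n
      then (?s' (shift_word M M' g V y) i t + E V i t) mod q else 0)" for i t
  proof (cases "i < C \<and> t < n")
    case True
    then have "shift_word M M' g V y i t = (y i t + shift M M' g V t i) mod q"
      by (simp add: shift_word_def)
    also have "y i t = (send M W (jammed (E V)) y i t + E V i t) mod q"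
      using closed_loopD(1)[OF cl', of i t] True by simp
    also have "(\<dots> + shift M M' g V t i) mod q
        = ((send M W (jammed (E V)) y i t + shift M M' g V t i) mod q + E V i t) mod q"
      by (simp add: mod_simps ac_simps)
    finally show ?thesis
      using True by (simp add: send_shift)
  next
    case False
    then show ?thesis
      by (auto simp: shift_word_def)
  qed
  moreover have "V = (\<lambda>j t. if j \<in> Zr \<and> t < n then ?s' (shift_word M M' g V y) j t mod q else 0)"
  proof (intro ext)
    fix j t
    show "V j t = (if j \<in> Zr \<and> t < n then ?s' (shift_word M M' g V y) j t mod q else 0)"
    proof (cases "j \<in> Zr \<and> t < n")
      case True
      then have "?s' (shift_word M M' g V y) j t = send M W (jammed (E V)) y j t mod q"
        using Zr by (subst send_shift) (auto simp: shift_Zr)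
      then show ?thesis
        using closed_loopD(2)[OF cl', of j t] True by simp
    next
      case False
      then show ?thesis
        using closed_loopD(2)[OF cl', of j t] by auto
    qed
  qed
  ultimately have "closed_loop q C n ?s' E Zr (shift_word M M' g V y) V"
    unfolding closed_loop_def by blast
  then show ?thesis
    using closed_loop_send[OF Zr(1)] by blast
qed

end

section \<open>Authentication and decoding\<close>

lemma card_bij_betw_invariant:
  assumes "bij_betw f A A"
  shows "card {x \<in> A. P (f x)} = card {x \<in> A. P x}"
proof -
  have "f ` {x \<in> A. P (f x)} = {x \<in> f ` A. P x}"
    by auto
  then have "f ` {x \<in> A. P (f x)} = {x \<in> A. P x}"
    by (simp only: bij_betw_imp_surj_on[OF assms])
  moreover have "inj_on f {x \<in> A. P (f x)}"
    using bij_betw_imp_inj_on[OF assms] by (rule inj_on_subset) auto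
  ultimately show ?thesis
    by (metis card_image)
qed

context scheme
begin

abbreviation "noise \<equiv> (\<Pi>\<^sub>E x\<in>{..<n} \<times> {..<C}. {..<q})"

lemma finite_noise: "finite noise" and noise_nonempty: "noise \<noteq> {}"
  using q_pos by (auto simp: finite_PiE PiE_eq_empty_iff)

text \<open>The support of a single link is enough. A majority vote would fail, since more than half
  of the links may be jammed.\<close>

definition find_log :: "(nat \<Rightarrow> nat \<Rightarrow> nat) \<Rightarrow> nat \<Rightarrow> nat set" where
  "find_log y = (SOME L. L \<in> jam_logs \<and> (\<exists>i<C. [y i (n - 1) = key y 0 * cd L + key y 1] (mod q)))"

definition decode_symbol :: "(nat \<Rightarrow> nat \<Rightarrow> nat) \<Rightarrow> (nat \<Rightarrow> nat set) \<Rightarrow> nat \<times> nat \<Rightarrow> nat" where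
  "decode_symbol y L = (\<lambda>(s, k). let t = (SOME t. t < n \<and> success L t \<and> chunk L t = s) in
     (\<Sum>j<C. j ^ k * (if j \<in> L t then y j (t - 1) else y j t)) mod q)"

text \<open>A success at \<open>t\<close> requires \<open>Suc t < n\<close>, so the log below
  \<open>n\<close> that Bob obtains suffices to recognise it.\<close>

lemma success_restrict: "success (restrict J {..<n}) t = success J t"
proof (cases "Suc t < n")
  case True
  then show ?thesis
    by (intro success_cong) auto
qed (auto simp: success_def data_slot_def)

lemma chunk_restrict: "chunk (restrict J {..<n}) t = chunk J t"
  by (simp add: chunk_def success_restrict)

end

context attacked_scheme
begin

abbreviation "view M W \<equiv> calvin_view q C n (alice M W) E Zr"
abbreviation "word M W \<equiv> recv q C (alice M W) E Zr n"

section \<open>The coupling as a bijection of the noise\<close>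

lemma replicate_ne: "replicate n (1::nat) \<noteq> []"
  using n_ge by auto

lemma closed_loop_word: "closed_loop q C n (alice M W) E Zr (word M W) (view M W)"
  by (rule closed_loop_recv[OF feedback_causal_alice replicate_ne E])

definition couple :: "(nat \<times> nat \<Rightarrow> nat) \<Rightarrow> (nat \<times> nat \<Rightarrow> nat) \<Rightarrow> nat \<Rightarrow> (nat \<times> nat \<Rightarrow> nat) \<Rightarrow> nat \<times> nat \<Rightarrow> nat"
  where "couple M M' g W = shift_noise M M' g (view M W) W"

text \<open>The shifted word and the old view solve the equations of the new run, and such solutions
  are unique.\<close>

lemma word_couple: "word M' (couple M M' g W) = shift_word M M' g (view M W) (word M W)"
  and view_couple: "view M' (couple M M' g W) = view M W"
  using closed_loop_unique[OF feedback_causal_alice replicate_ne E closed_loop_word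
      closed_loop_shift[OF closed_loop_word], of M' M g W]
  unfolding couple_def by blast+

text \<open>Equal images have equal views, and the view determines the translation; so the map is
  injective on a finite set.\<close>

lemma bij_couple: "bij_betw (couple M M' g) noise noise"
proof -
  have into: "couple M M' g ` noise \<subseteq> noise"
    unfolding couple_def shift_noise_def using q_pos
    by (intro image_subsetI) (simp add: restrict_PiE_iff split_beta)
  have inj: "inj_on (couple M M' g) noise"
  proof (rule inj_onI)
    fix W1 W2 assume W: "W1 \<in> noise" "W2 \<in> noise" and eq: "couple M M' g W1 = couple M M' g W2"
    have view: "view M W1 = view M W2"
      using view_couple[of M' M g W1] view_couple[of M' M g W2] eq by simp
    show "W1 = W2"
    proof (rule PiE_ext[OF W])
      fix x assume x: "x \<in> {..<n} \<times> {..<C}"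
      obtain t i where ti: "x = (t, i)"
        by (cases x)
      have "[W1 x + shift M M' g (view M W2) t i = W2 x + shift M M' g (view M W2) t i] (mod q)"
        using fun_cong[OF eq, of x] x by (simp add: couple_def shift_noise_def view ti cong_def)
      then have "[W1 x = W2 x] (mod q)"
        by (simp add: cong_add_rcancel_nat)
      moreover have "W1 x < q" "W2 x < q"
        using W x by (auto simp: PiE_iff)
      ultimately show "W1 x = W2 x"
        by (simp add: cong_def)
    qed
  qed
  show ?thesis
    unfolding bij_betw_def using inj into finite_noise endo_inj_surj by blast
qed

lemma view_law: "map_pmf (view M) (pmf_of_set noise) = map_pmf (view M') (pmf_of_set noise)"
proof -
  have "map_pmf (view M') (pmf_of_set noise)
      = map_pmf (view M') (map_pmf (couple M M' 0) (pmf_of_set noise))"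
    by (simp only: map_pmf_of_set_bij_betw[OF bij_couple noise_nonempty finite_noise])
  also have "\<dots> = map_pmf (view M) (pmf_of_set noise)"
    by (simp only: map_pmf_comp view_couple)
  finally show ?thesis ..
qed

abbreviation "jam_log V \<equiv> restrict (jammed (E V)) {..<n}"

lemma jam_log_in: "jam_log V \<in> jam_logs"
  using jammed_subset_links by (simp add: restrict_PiE_iff)

text \<open>The multiplicative keys for which some link of the last slot shows Bob a wrong jam log.\<close>

definition forgeable :: "(nat \<Rightarrow> nat \<Rightarrow> nat) \<Rightarrow> nat set" where
  "forgeable V = {a. a < q \<and> (\<exists>i<C. \<exists>L\<in>jam_logs. L \<noteq> jam_log V \<and>
     [E V i (n - 1) + a * cd (jam_log V) = a * cd L] (mod q))}"

text \<open>For a fixed link and a fixed wrong log the condition is linear in \<open>a\<close> with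
  a coefficient nonzero modulo the prime \<open>q\<close>, so at most one \<open>a\<close> satisfies
  it.\<close>

lemma card_forgeable: "card (forgeable V) \<le> C * S"
proof -
  define B where "B = (\<lambda>(i, L). {a. a < q \<and> [E V i (n - 1) + a * cd (jam_log V) = a * cd L] (mod q)})"
  have fin: "finite jam_logs"
    by (simp add: finite_PiE)
  have cd_q: "cd L < q" if "L \<in> jam_logs" for L
    using subsetD[OF cd_less imageI[OF that]] S_le_q by simp
  have B: "card (B x) \<le> 1" if x: "x \<in> {..<C} \<times> (jam_logs - {jam_log V})" for x
  proof -
    obtain i L where L: "x = (i, L)" "L \<in> jam_logs" "L \<noteq> jam_log V"
      using x by auto
    have "a = a'" if "a \<in> B x" "a' \<in> B x" for a a'
    proof -
      have a: "a < q" "a' < q"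
        and c: "[E V i (n - 1) + a * cd (jam_log V) = a * cd L] (mod q)"
        and c': "[E V i (n - 1) + a' * cd (jam_log V) = a' * cd L] (mod q)"
        using that by (auto simp: B_def L(1))
      have "[int (E V i (n - 1) + a * cd (jam_log V)) - int (E V i (n - 1) + a' * cd (jam_log V))
          = int (a * cd L) - int (a' * cd L)] (mod int q)"
        using c c' by (intro cong_diff) (simp_all only: cong_int_iff)
      then have "int q dvd (int a - int a') * (int (cd (jam_log V)) - int (cd L))"
        by (simp add: cong_iff_dvd_diff algebra_simps)
      then have "int q dvd int a - int a' \<or> int q dvd int (cd (jam_log V)) - int (cd L)"
        using prime_q by (simp add: prime_dvd_mult_iff)
      moreover have "\<not> int q dvd int (cd (jam_log V)) - int (cd L)"
      proof
        assume "int q dvd int (cd (jam_log V)) - int (cd L)"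
        then have "[cd (jam_log V) = cd L] (mod q)"
          by (simp add: cong_iff_dvd_diff flip: cong_int_iff)
        then have "cd (jam_log V) = cd L"
          using cd_q[OF L(2)] cd_q[OF jam_log_in] by (simp add: cong_def)
        then show False
          using cd_inj L jam_log_in by (metis inj_onD)
      qed
      ultimately have "[a = a'] (mod q)"
        by (simp add: cong_iff_dvd_diff flip: cong_int_iff)
      then show ?thesis
        using a by (simp add: cong_def)
    qed
    moreover have "finite (B x)"
      by (auto simp: B_def L(1))
    ultimately show ?thesis
      using card_le_Suc0_iff_eq[of "B x"] by simp
  qed
  have "forgeable V = (\<Union>x\<in>{..<C} \<times> (jam_logs - {jam_log V}). B x)"
    unfolding forgeable_def B_def by auto
  then have "card (forgeable V) \<le> (\<Sum>x\<in>{..<C} \<times> (jam_logs - {jam_log V}). card (B x))"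
    using fin by (simp add: card_UN_le)
  also have "\<dots> \<le> (\<Sum>x\<in>{..<C} \<times> (jam_logs - {jam_log V}). 1)"
    by (rule sum_mono) (rule B)
  also have "\<dots> = C * card (jam_logs - {jam_log V})"
    by (simp add: card_cartesian_product)
  also have "card (jam_logs - {jam_log V}) \<le> card jam_logs"
    using fin by (intro card_mono) auto
  also have "card jam_logs \<le> S"
    using card_inj_on_le[OF cd_inj cd_less] by simp
  finally show ?thesis
    by simp
qed

text \<open>Double counting of pairs of noise and \<open>g\<close>. Coupling \<open>M\<close> with
  itself adds \<open>g\<close> to the key without changing the view, so each noise meets at most
  \<open>C * S\<close> bad values of \<open>g\<close>, while each \<open>g\<close> sees the same
  number of bad noises.\<close>

lemma card_forged_noise:
  "q * card {W \<in> noise. key (word M W) 0 mod q \<in> forgeable (view M W)} \<le> card noise * (C * S)"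
proof -
  define P where "P = (\<lambda>W. key (word M W) 0 mod q \<in> forgeable (view M W))"
  have same: "card {W \<in> noise. P (couple M M g W)} = card {W \<in> noise. P W}" for g
    using bij_couple by (rule card_bij_betw_invariant)
  have rotated: "P (couple M M g W) \<longleftrightarrow> (key (word M W) 0 + g) mod q \<in> forgeable (view M W)" for g W
    using key_0_shift_word[of M M g "view M W" "word M W"]
    by (simp add: P_def word_couple view_couple cong_def)
  have few: "card {g. g < q \<and> P (couple M M g W)} \<le> C * S" for W
  proof -
    let ?f = "\<lambda>g. (key (word M W) 0 + g) mod q"
    have "card {g. g < q \<and> P (couple M M g W)} \<le> card (forgeable (view M W))"
    proof (rule card_inj_on_le)
      show "inj_on ?f {g. g < q \<and> P (couple M M g W)}"
      proof (rule inj_onI)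
        fix g g' assume g: "g \<in> {g. g < q \<and> P (couple M M g W)}" "g' \<in> {g. g < q \<and> P (couple M M g W)}"
          and "?f g = ?f g'"
        then have "[g = g'] (mod q)"
          by (metis cong_def cong_add_lcancel_nat)
        then show "g = g'"
          using g by (simp add: cong_def)
      qed
      show "?f ` {g. g < q \<and> P (couple M M g W)} \<subseteq> forgeable (view M W)"
        by (auto simp: rotated)
      show "finite (forgeable (view M W))"
        by (rule finite_subset[of _ "{..<q}"]) (auto simp: forgeable_def)
    qed
    then show ?thesis
      using card_forgeable le_trans by blast
  qed
  have "q * card {W \<in> noise. P W} = (\<Sum>g<q. card {W \<in> noise. P (couple M M g W)})"
    by (simp add: same)
  also have "\<dots> = (\<Sum>g<q. \<Sum>W\<in>noise. if P (couple M M g W) then 1 else 0)"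
    using finite_noise by (intro sum.cong refl) (simp add: sum.If_cases Int_def)
  also have "\<dots> = (\<Sum>W\<in>noise. \<Sum>g<q. if P (couple M M g W) then 1 else 0)"
    by (rule sum.swap)
  also have "\<dots> = (\<Sum>W\<in>noise. card {g. g < q \<and> P (couple M M g W)})"
    by (intro sum.cong refl) (simp add: sum.If_cases Int_def)
  also have "\<dots> \<le> (\<Sum>W\<in>noise. C * S)"
    by (rule sum_mono) (rule few)
  also have "\<dots> = card noise * (C * S)"
    by simp
  finally show ?thesis
    by (simp only: P_def)
qed

context
  fixes M W y V
  assumes cl: "closed_loop q C n (alice M W) E Zr y V"
    and safe: "key y 0 mod q \<notin> forgeable V"
begin

lemma received_symbol:
  assumes "i < C" "t < n"
  shows "y i t = (send M W (jammed (E V)) y i t + E V i t) mod q"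
  using closed_loopD(1)[OF cl[unfolded closed_loop_send[OF Zr(1)]], of i t] assms by simp

text \<open>Since \<open>d > 0\<close>, some link is never jammed and supports the true log; any
  other supported log would make the key forgeable.\<close>

lemma find_log_correct: "find_log y = jam_log V"
proof -
  have n: "n - 1 < n" "Suc (n - 1) = n"
    using n_ge by auto
  have last: "[y i (n - 1) = key y 0 * cd (jam_log V) + key y 1 + E V i (n - 1)] (mod q)" if "i < C" for i
    using received_symbol[OF that n(1)] n(2) by (simp add: send_def cong_def mod_simps)
  have unique: "L = jam_log V"
    if L: "L \<in> jam_logs" and i: "i < C" "[y i (n - 1) = key y 0 * cd L + key y 1] (mod q)" for L i
  proof (rule ccontr)
    assume ne: "L \<noteq> jam_log V"
    have "[key y 0 * cd (jam_log V) + key y 1 + E V i (n - 1) = key y 0 * cd L + key y 1] (mod q)"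
      using cong_trans[OF cong_sym[OF last[OF i(1)]] i(2)] .
    then have "[(E V i (n - 1) + key y 0 * cd (jam_log V)) + key y 1 = key y 0 * cd L + key y 1] (mod q)"
      by (simp add: ac_simps)
    then have "[E V i (n - 1) + key y 0 * cd (jam_log V) = key y 0 * cd L] (mod q)"
      by (simp only: cong_add_rcancel_nat)
    moreover have "[(key y 0 mod q) * c = key y 0 * c] (mod q)" for c
      by (simp add: cong_def mod_simps)
    ultimately have forged:
      "[E V i (n - 1) + (key y 0 mod q) * cd (jam_log V) = (key y 0 mod q) * cd L] (mod q)"
      by (meson cong_add cong_refl cong_sym cong_trans)
    have "key y 0 mod q \<in> forgeable V"
      unfolding forgeable_def
      by (intro CollectI conjI exI[of _ i] bexI[OF _ L] ne i(1) forged) (use q_pos in simp)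
    then show False
      using safe by blast
  qed
  have "\<exists>i. i < C \<and> i \<notin> Zw"
  proof (rule ccontr)
    assume "\<nexists>i. i < C \<and> i \<notin> Zw"
    then have "card {..<C} \<le> card Zw"
      using finite_links by (intro card_mono) auto
    then show False
      using Zw(2) d_pos d_le by simp
  qed
  then obtain i where i: "i < C" "i \<notin> Zw"
    by blast
  then have "[y i (n - 1) = key y 0 * cd (jam_log V) + key y 1] (mod q)"
    using last[OF i(1)] no_jamming[OF i(2), of V "n - 1"] by simp
  then have "\<exists>L. L \<in> jam_logs \<and> (\<exists>i<C. [y i (n - 1) = key y 0 * cd L + key y 1] (mod q))"
    by (intro exI[of _ "jam_log V"] exI[of _ i] conjI jam_log_in i(1))
  from someI_ex[OF this, folded find_log_def] obtain i' where
    "find_log y \<in> jam_logs" "i' < C" "[y i' (n - 1) = key y 0 * cd (find_log y) + key y 1] (mod q)"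
    by blast
  then show ?thesis
    by (rule unique)
qed

lemma decode_symbol_correct:
  assumes s: "s < card {t. t < n \<and> success (jammed (E V)) t}" and k: "k < d" and M: "M (s, k) < q"
  shows "decode_symbol y (find_log y) (s, k) = M (s, k)"
proof -
  let ?J = "jammed (E V)"
  define t where "t = (SOME t. t < n \<and> success ?J t \<and> chunk ?J t = s)"
  have "\<exists>t. t < n \<and> success ?J t \<and> chunk ?J t = s"
    using rank_exists[OF s] unfolding chunk_def by blast
  from someI_ex[OF this, folded t_def]
  have t: "t < n" "success ?J t" "chunk ?J t = s"
    by auto
  then have data: "data_slot ?J t" and J: "?J (Suc t) = ?J t"
    by (auto simp: success_def)
  have "Suc t \<noteq> n"
    using data by (simp add: data_slot_def)
  have good: "[int (y j t) = int (if j \<in> pivots ?J t then send M W ?J y j t else W (t, j))] (mod int q)"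
    if "j < C" "j \<notin> ?J t" for j
  proof -
    \<comment> \<open>Success means that the jammed set does not grow during slot \<open>t\<close>,
      so a link outside it is clean in this very slot.\<close>
    have "E V j t mod q = 0"
      using that unfolding J[symmetric] by (auto simp: jammed_def)
    then have "y j t = send M W ?J y j t"
      using received_symbol[OF that(1) t(1)] add_mod_eq_self_iff[OF send_less] by simp
    moreover have "send M W ?J y j t = W (t, j) mod q" if "j \<notin> pivots ?J t"
      using that \<open>Suc t \<noteq> n\<close> by (simp add: send_def)
    ultimately show ?thesis
      by (auto simp: cong_int_iff)
  qed
  have "[(\<Sum>j<C. int j ^ k * int (if j \<in> ?J t then y j (t - 1) else y j t))
      = (\<Sum>j<C. int j ^ k * int (if j \<in> ?J t then y j (t - 1)
        else if j \<in> pivots ?J t then send M W ?J y j t else W (t, j)))] (mod int q)"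
    by (intro cong_sum cong_mult cong_refl) (use good in auto)
  from cong_trans[OF this power_sum_send[OF data k]]
  have "[int (\<Sum>j<C. j ^ k * (if j \<in> ?J t then y j (t - 1) else y j t)) = int (M (s, k))] (mod int q)"
    by (simp add: t(3))
  then have "(\<Sum>j<C. j ^ k * (if j \<in> ?J t then y j (t - 1) else y j t)) mod q = M (s, k)"
    using M by (simp only: cong_int_iff) (simp add: cong_def)
  moreover have "(SOME t. t < n \<and> success (jam_log V) t \<and> chunk (jam_log V) t = s) = t"
    by (simp only: success_restrict chunk_restrict t_def)
  moreover have "jam_log V t = ?J t"
    using t(1) by simp
  ultimately show ?thesis
    by (simp only: find_log_correct decode_symbol_def Let_def split)
qed

end

text \<open>The slots from 3 to \<open>n - 2\<close> are \<open>n - 4\<close> candidates. Each of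
  the at most \<open>C\<close> growth steps of the jammed set spoils its own slot and the next
  one.\<close>

lemma card_success: "n - 4 - 2 * C \<le> card {t. t < n \<and> success (jammed (E V)) t}"
proof -
  let ?J = "jammed (E V)"
  define Ch where "Ch = {t. t < n \<and> ?J (Suc t) \<noteq> ?J t}"
  have fin: "finite Ch"
    by (simp add: Ch_def)
  have "card Ch \<le> card (?J n)"
    unfolding Ch_def by (rule card_changes_le) (auto simp: jammed_def less_Suc_eq)
  also have "\<dots> \<le> C"
    using card_mono[OF _ jammed_subset_links, of V n] by simp
  finally have Ch: "card Ch \<le> C" .
  have "{3..<n - 1} \<subseteq> {t. t < n \<and> success ?J t} \<union> Ch \<union> Suc ` Ch"
  proof
    fix t assume t: "t \<in> {3..<n - 1}"
    then obtain t0 where t0: "t = Suc t0"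
      by (cases t) auto
    show "t \<in> {t. t < n \<and> success ?J t} \<union> Ch \<union> Suc ` Ch"
      using t unfolding t0 Ch_def success_def data_slot_def by auto
  qed
  then have "card {3..<n - 1} \<le> card ({t. t < n \<and> success ?J t} \<union> Ch \<union> Suc ` Ch)"
    using fin by (intro card_mono) auto
  also have "\<dots> \<le> card {t. t < n \<and> success ?J t} + card Ch + card (Suc ` Ch)"
    by (meson add_le_mono card_Un_le le_refl le_trans)
  also have "\<dots> \<le> card {t. t < n \<and> success ?J t} + C + C"
    using Ch card_image_le[OF fin, of Suc] by simp
  finally show ?thesis
    by simp
qed

end

section \<open>Capacity\<close>

context scheme
begin

text \<open>The number of chunks is the number of successful slots that \<open>card_success\<close>
  guarantees.\<close>

abbreviation "messages \<equiv> (\<Pi>\<^sub>E x\<in>{..<n - 4 - 2 * C} \<times> {..<d}. {..<q})"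

definition decode :: "(nat \<Rightarrow> nat \<Rightarrow> nat) \<Rightarrow> nat \<times> nat \<Rightarrow> nat" where
  "decode y = restrict (decode_symbol y (find_log y)) ({..<n - 4 - 2 * C} \<times> {..<d})"

end

context attacked_scheme
begin

lemma decode_correct:
  assumes M: "M \<in> messages" and safe: "key (word M W) 0 mod q \<notin> forgeable (view M W)"
  shows "decode (word M W) = M"
proof (rule PiE_ext[where k = "{..<n - 4 - 2 * C} \<times> {..<d}"])
  show "M \<in> messages"
    by (rule M)
  have at: "decode (word M W) x = M x" if x: "x \<in> {..<n - 4 - 2 * C} \<times> {..<d}" for x
  proof -
    obtain s k where sk: "x = (s, k)" "s < n - 4 - 2 * C" "k < d"
      using x by auto
    have "s < card {t. t < n \<and> success (jammed (E (view M W))) t}"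
      using sk(2) card_success[of "view M W"] by linarith
    moreover have "M (s, k) < q"
      using M x sk(1) by (auto simp: PiE_iff)
    ultimately have "decode_symbol (word M W) (find_log (word M W)) (s, k) = M (s, k)"
      using decode_symbol_correct[OF closed_loop_word safe] sk(3) by blast
    then show ?thesis
      using x by (simp add: decode_def sk(1))
  qed
  show "decode (word M W) x = M x" if "x \<in> {..<n - 4 - 2 * C} \<times> {..<d}" for x
    using that by (rule at)
  show "decode (word M W) \<in> messages"
  proof (rule PiE_I)
    show "decode (word M W) x \<in> {..<q}" if "x \<in> {..<n - 4 - 2 * C} \<times> {..<d}" for x
      using at[OF that] PiE_mem[OF M that] by simp
    show "decode (word M W) x = undefined" if "x \<notin> {..<n - 4 - 2 * C} \<times> {..<d}" for x
      using that by (simp only: decode_def restrict_def if_False)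
  qed
qed

lemma decode_error_prob:
  assumes M: "M \<in> messages"
  shows "measure_pmf.prob (pmf_of_set noise) {W. decode (word M W) \<noteq> M} \<le> real (C * S) / real q"
proof -
  let ?bad = "{W \<in> noise. key (word M W) 0 mod q \<in> forgeable (view M W)}"
  have "card (noise \<inter> {W. decode (word M W) \<noteq> M}) \<le> card ?bad"
    using decode_correct[OF M] finite_noise by (intro card_mono) auto
  then have "q * card (noise \<inter> {W. decode (word M W) \<noteq> M}) \<le> q * card ?bad"
    by (rule mult_le_mono2)
  also have "\<dots> \<le> card noise * (C * S)"
    by (rule card_forged_noise)
  finally have "real q * real (card (noise \<inter> {W. decode (word M W) \<noteq> M}))
      \<le> real (card noise) * real (C * S)"
    by (simp only: of_nat_mult[symmetric] of_nat_le_iff)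
  moreover have "card noise > 0"
    using finite_noise noise_nonempty by (simp only: card_gt_0_iff simp_thms)
  ultimately show ?thesis
    unfolding measure_pmf_of_set[OF noise_nonempty finite_noise]
    using q_pos by (simp add: field_simps)
qed

end

text \<open>A code with one message; it makes the set of rates nonempty and settles the case of
  capacity zero.\<close>

lemma achievable_0: "achievable C zrw zro zwo 0"
  unfolding achievable_iff
proof (intro allI impI exI)
  fix \<epsilon> :: real and n assume \<epsilon>: "\<epsilon> > 0"
  show "reliable_secret_code C zrw zro zwo 0 \<epsilon> n 2 1 [n] (return_pmf 0) (\<lambda>_ _ _ _ _. 0) (\<lambda>_. 0)"
    using \<epsilon> by (auto simp: reliable_secret_code_def feedback_causal_def error_prob_def
        intro!: perfectly_secretI)
qed

lemma achievable_below:
  assumes z: "zrw + zro \<le> C - d" "zrw + zwo \<le> C - d" and d: "0 < d" "d \<le> C"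
    and R: "R < real d"
  shows "achievable C zrw zro zwo R"
  unfolding achievable_iff
proof (intro allI impI)
  fix \<epsilon> :: real assume \<epsilon>: "\<epsilon> > 0"
  \<comment> \<open>From here on \<open>n * (d - R)\<close> exceeds \<open>d * (4 + 2 * C)\<close>,
    the message symbols lost to key slots, repetitions and the final slot.\<close>
  obtain N0 where N0: "real d * real (4 + 2 * C) / (real d - R) < real N0"
    using reals_Archimedean2 by blast
  show "\<exists>N. \<forall>n\<ge>N. \<exists>q K ls P enc dec. reliable_secret_code C zrw zro zwo R \<epsilon> n q K ls P enc dec"
  proof (rule exI[of _ "N0 + 4 + 2 * C"], intro allI impI)
    fix n assume n: "N0 + 4 + 2 * C \<le> n"
    define S where "S = card (\<Pi>\<^sub>E t\<in>{..<n}. Pow {..<C})"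
    obtain cd where cd: "bij_betw cd (\<Pi>\<^sub>E t\<in>{..<n}. Pow {..<C}) {0..<S}"
      using ex_bij_betw_finite_nat[of "\<Pi>\<^sub>E t\<in>{..<n}. Pow {..<C}"] unfolding S_def
      by (auto simp: finite_PiE)
    \<comment> \<open>One prime meets three demands: distinct nodes for the links, room for the
      codes of all jam logs, and a forging probability below \<open>\<epsilon>\<close>.\<close>
    obtain q where q: "prime q" "C + S + nat \<lceil>real (C * S) / \<epsilon>\<rceil> < q"
      using bigger_prime by blast
    interpret scheme q n C d S cd
      using q n d(2) cd by unfold_locales (auto simp: bij_betw_def atLeast0LessThan)
    have "real (C * S) / \<epsilon> < real q"
      using q(2) by linarith
    then have CSq: "real (C * S) / real q < \<epsilon>"
      using \<epsilon> q_pos by (simp add: field_simps)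
    define K where "K = card messages"
    have K: "K = q ^ ((n - 4 - 2 * C) * d)"
      by (simp add: K_def card_PiE card_cartesian_product)
    have K_pos: "K \<ge> 1"
      using q_pos by (simp add: K Suc_le_eq)
    obtain mf where mf: "bij_betw mf {..<K} messages"
      using ex_bij_betw_nat_finite[of messages] unfolding K_def
      by (auto simp: finite_PiE atLeast0LessThan)
    obtain wf where wf: "bij_betw wf {..<card noise} noise"
      using ex_bij_betw_nat_finite[OF finite_noise] by (auto simp: atLeast0LessThan)
    define P where "P = pmf_of_set {..<card noise}"
    have P: "map_pmf wf P = pmf_of_set noise"
      unfolding P_def using finite_noise noise_nonempty wf
      by (intro map_pmf_of_set_bij_betw) (auto simp: lessThan_empty_iff card_gt_0_iff)
    define enc where "enc = (\<lambda>m u. alice (mf m) (wf u))"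
    define dec where "dec = (\<lambda>y. inv_into {..<K} mf (decode y))"
    have "reliable_secret_code C zrw zro zwo R \<epsilon> n q K (replicate n 1) P enc dec"
      unfolding reliable_secret_code_def
    proof (intro conjI allI impI)
      show "q \<ge> 2"
        using q(1) by (rule prime_ge_2_nat)
      show "K \<ge> 1"
        by (rule K_pos)
      show "real q powr (real n * R) \<le> real K"
      proof -
        have "real d * real (4 + 2 * C) < real N0 * (real d - R)"
          using N0 R by (simp add: field_simps)
        also have "\<dots> \<le> real n * (real d - R)"
          using n R by (intro mult_right_mono) auto
        finally have "real n * R \<le> (real n - real (4 + 2 * C)) * real d"
          by (simp add: algebra_simps)
        also have "\<dots> = real ((n - 4 - 2 * C) * d)"
          using n by (simp add: of_nat_diff)
        finally have "real q powr (real n * R) \<le> real q powr real ((n - 4 - 2 * C) * d)"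
          using q_pos by (intro powr_mono) auto
        also have "\<dots> = real K"
          using q_pos by (simp add: K powr_realpow del: of_nat_mult)
        finally show ?thesis .
      qed
      show "replicate n (1::nat) \<noteq> []"
        using n_ge by auto
      show "sum_list (replicate n 1) = n"
        by (simp add: sum_list_replicate)
      show "feedback_causal C (replicate n 1) (enc m u)" for m u
        unfolding enc_def by (rule feedback_causal_alice)
    next
      fix Zrw Zro Zwo E
      assume adm: "admissible_sets C zrw zro zwo Zrw Zro Zwo"
        and E: "causal_jammer (Zrw \<union> Zro) (Zrw \<union> Zwo) E"
      have cards: "card (Zrw \<union> Zro) \<le> C - d" "card (Zrw \<union> Zwo) \<le> C - d"
        using adm z card_Un_le[of Zrw Zro] card_Un_le[of Zrw Zwo]
        unfolding admissible_sets_def by linarith+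
      have sub: "Zrw \<union> Zro \<subseteq> {..<C}" "Zrw \<union> Zwo \<subseteq> {..<C}"
        using adm unfolding admissible_sets_def by blast+
      interpret attacked_scheme q n C d S cd "Zrw \<union> Zro" "Zrw \<union> Zwo" E
        using cards sub d(1) E by unfold_locales auto
      have "measure_pmf.prob P {u. dec (recv q C (enc m u) E (Zrw \<union> Zro) n) \<noteq> m}
          < \<epsilon>" if m: "m < K" for m
      proof -
        have M: "mf m \<in> messages"
          using mf m by (auto simp: bij_betw_def)
        have inv: "inv_into {..<K} mf (mf m) = m"
          using mf m by (simp add: bij_betw_def)
        have "measure_pmf.prob P {u. dec (recv q C (enc m u) E (Zrw \<union> Zro) n) \<noteq> m}
            \<le> measure_pmf.prob P {u. decode (word (mf m) (wf u)) \<noteq> mf m}"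
          by (rule measure_pmf.finite_measure_mono) (auto simp: dec_def enc_def inv)
        also have "\<dots> = measure_pmf.prob (map_pmf wf P) {W. decode (word (mf m) W) \<noteq> mf m}"
          by (simp add: vimage_def)
        also have "\<dots> \<le> real (C * S) / real q"
          unfolding P by (rule decode_error_prob[OF M])
        finally show ?thesis
          using CSq by simp
      qed
      then have "(\<Sum>m<K. measure_pmf.prob P {u. dec (recv q C (enc m u) E (Zrw \<union> Zro) n) \<noteq> m})
          < (\<Sum>m<K. \<epsilon>)"
        using K_pos by (intro sum_strict_mono) (auto simp: lessThan_empty_iff)
      then show "error_prob q C n K P enc dec E (Zrw \<union> Zro) < \<epsilon>"
        using K_pos by (simp add: error_prob_def field_simps)
      show "perfectly_secret q C n K P enc E (Zrw \<union> Zro)"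
      proof (rule perfectly_secretI[OF K_pos])
        fix m
        have "map_pmf (\<lambda>u. calvin_view q C n (enc m u) E (Zrw \<union> Zro)) P
            = map_pmf (view (mf m)) (map_pmf wf P)"
          by (simp only: enc_def map_pmf_comp)
        also have "\<dots> = map_pmf (view (mf 0)) (pmf_of_set noise)"
          unfolding P by (rule view_law)
        finally show "map_pmf (\<lambda>u. calvin_view q C n (enc m u) E (Zrw \<union> Zro)) P
            = map_pmf (view (mf 0)) (pmf_of_set noise)" .
      qed
    qed
    then show "\<exists>q K ls P enc dec. reliable_secret_code C zrw zro zwo R \<epsilon> n q K ls P enc dec"
      by blast
  qed
qed

theorem theorem9:
  fixes C zrw zro zwo :: nat
  assumes "zrw + zro + zwo \<le> C"
  shows "capacity C zrw zro zwo =
     (let zr = zrw + zro; zw = zrw + zwo in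
      if zr \<ge> zw then max 0 (real C - real zr) else max 0 (real C - real zw))"
proof -
  define z where "z = max (zrw + zro) (zrw + zwo)"
  have z: "z \<le> C"
    using assms by (simp add: z_def)
  have "Sup {R. achievable C zrw zro zwo R} = real C - real z"
  proof (rule cSup_eq_non_empty)
    show "{R. achievable C zrw zro zwo R} \<noteq> {}"
      using achievable_0 by blast
    show "R \<le> real C - real z" if "R \<in> {R. achievable C zrw zro zwo R}" for R
      using achievable_le[OF assms, of R] that by (simp add: z_def)
    show "real C - real z \<le> b" if ub: "\<And>R. R \<in> {R. achievable C zrw zro zwo R} \<Longrightarrow> R \<le> b" for b
    \<comment> \<open>The construction requires \<open>d = C - z\<close> to be positive; otherwise
      the trivial code already attains the bound.\<close>
    proof (cases "z = C")
      case True
      then show ?thesis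
        using ub[of 0] achievable_0 by simp
    next
      case False
      have "R \<le> b" if R: "R < real C - real z" for R
      proof -
        have "achievable C zrw zro zwo R"
        proof (rule achievable_below[where d = "C - z"])
          show "zrw + zro \<le> C - (C - z)" "zrw + zwo \<le> C - (C - z)"
            using z by (simp_all add: z_def)
        qed (use z False R in \<open>auto simp: of_nat_diff\<close>)
        then show ?thesis
          using ub by simp
      qed
      \<comment> \<open>Only rates strictly below \<open>C - z\<close> are constructed; density of
        the reals carries the bound to the supremum.\<close>
      then show ?thesis
        by (rule dense_le)
    qed
  qed
  then show ?thesis
    using z unfolding capacity_def by (simp add: z_def Let_def max_def of_nat_diff split: if_splits)
qed

end
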